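(* Let $X$ be a diffeological space and $A$ a diffeological abelian group. Then $$\check H^0_\infty(X,A)\cong\check H^0_{PIZ}(X,A)\cong\check H^0_{KWW}(X,A)\cong C^\infty(X,A),$$ where $C^\infty(X,A)$ is the group of smooth maps $X\to A$.
   Context: Diffeology. A cartesian space is a smooth manifold diffeomorphic to $\mathbb{R}^n$ for some $n\ge 0$; $\mathsf{Cart}$ is the category of cartesian spaces and smooth maps, regarded as small. A good open cover of a manifold is an open cover $\{U_i\}$ by cartesian spaces all of whose finite non-empty intersections are cartesian spaces. A diffeological space is a set $X$ with a collection of functions $p:U\to X$, $U\in\mathsf{Cart}$, called plots, such that (1) every map $\mathbb{R}^0\to X$ is a plot; (2) if $p:U\to X$ is a plot and $f:V\to U$ is smooth, then $pf$ is a plot; (3) if $p:U\to X$ is a function and $p|_{U_i}$ is a plot for every member of some good open cover $\{U_i\subseteq U\}$, then $p$ is a plot. A function $f:X\to Y$ is smooth if $fp$ is a plot of $Y$ for every plot $p$ of $X$. Limits and colimits are formed on underlying sets: a function into a limit is a plot iff all its components are; a function $U\to\mathrm{colim}\,F$ is a plot iff on the members of some good open cover of $U$ it lifts to plots of the terms of the diagram. The functional diffeology on $C^\infty(X,Y)$ has as plots the $p:U\to C^\infty(X,Y)$ with $(u,x)\mapsto p(u)(x)$ smooth; subsets carry the subspace diffeology. A diffeological abelian group is an abelian group with a diffeology for which addition and inversion are smooth. Maps of plots $f_0:U_{p_1}\to U_{p_0}$ of $X$ are smooth maps with $p_0f_0=p_1$. Three simplicial diffeological spaces. Let $B=\coprod_pU_p$,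 over all plots $p:U_p\to X$, and $\pi:B\to X$, $\pi(x_p)=p(x_p)$. (a) $QX$: $QX_k=\coprod_{U_{p_k}\xrightarrow{f_{k-1}}\cdots\xrightarrow{f_0}U_{p_0}}U_{p_k}$, over chains of $k$ composable maps of plots, with $d_0(x_{p_k},f_{k-1},\dots,f_0)=(f_{k-1}(x_{p_k}),f_{k-2},\dots,f_0)$, inner faces composing consecutive maps, $d_k$ dropping $f_0$, degeneracies inserting identities; so $QX_0=B$. Also regard it as a simplicial presheaf on $\mathsf{Cart}$ (coproducts of representables). (b) $N(B//M)$: the nerve of the diffeological category with objects $B$ and morphisms $B\times M$, where $M=\{m\in C^\infty(B,B):\pi m=\pi\}$ with the subspace diffeology of the functional diffeology, source $(b,m)\mapsto b$, target $(b,m)\mapsto m(b)$, composition given by composition in $M$; $N(B//M)_k\cong B\times M^{k}$. (c) $N\check C(X)$: the nerve of the diffeological groupoid with objects $B$, morphisms $B\times_XB$, source and target the projections; $N\check C(X)_k$ is the $(k+1)$-fold fiber product of $B$ over $X$. Cohomologies. For a simplicial diffeological space $S$, $[k]\mapsto C^\infty(S_k,A)$ is a cosimplicial abelian group, with associated cochain complex with differential $d=\sum_{i=0}^{n+1}(-1)^id^i$ in degree $n$. $\check H^k_{PIZ}(X,A)$ and $\check H^k_{KWW}(X,A)$ are the $k$th cohomology groups of this complex for $S=N(B//M)$ and $S=N\check C(X)$ respectively. $\check H^0_\infty(X,A)=\pi_0\,\underline{\mathsf{sPre}(\mathsf{Cart})}(QX,A)$, where $A$ is the discrete simplicial presheaf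 $U\mapsto C^\infty(U,A)$ and $\underline{\mathsf{sPre}(\mathsf{Cart})}(Y,Z)_n$ is the set of maps of simplicial presheaves $Y\times\Delta^n\to Z$ ($\Delta^n$ constant). *)

theory Defs
  imports "HOL-Analysis.Analysis" "HOL-Algebra.Coset" "HOL-Algebra.FiniteProduct"
begin

section \<open>Cartesian spaces\<close>

text \<open>
  A pair \<open>(n, U)\<close> stands for the subset \<open>U\<close> of \<open>\<real>\<^sup>n\<close>, where \<open>\<real>\<^sup>n\<close> is
  \<^term>\<open>topspace (Euclidean_space n)\<close>, the sequences vanishing from index \<open>n\<close> on.
\<close>

type_synonym vec = "nat \<Rightarrow> real"
type_synonym dom = "nat \<times> vec set"

abbreviation carr :: "dom \<Rightarrow> vec set" where "carr U \<equiv> snd U"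

definition open_dom :: "dom \<Rightarrow> bool" where
  "open_dom U \<longleftrightarrow> openin (Euclidean_space (fst U)) (carr U)"

text \<open>\<open>Ck k U f\<close>: all iterated partial derivatives of \<open>f\<close> of order at most \<open>k\<close> exist and are
  continuous on \<open>U\<close>; meaningful for open \<open>U\<close>.\<close>

fun Ck :: "nat \<Rightarrow> dom \<Rightarrow> (vec \<Rightarrow> real) \<Rightarrow> bool" where
  "Ck 0 U f \<longleftrightarrow>
     continuous_map (subtopology (Euclidean_space (fst U)) (carr U)) euclideanreal f"
| "Ck (Suc k) U f \<longleftrightarrow>
     continuous_map (subtopology (Euclidean_space (fst U)) (carr U)) euclideanreal f \<and>
     (\<forall>i<fst U. \<exists>g. Ck k U g \<and>
        (\<forall>x\<in>carr U. ((\<lambda>t. f (x(i := t))) has_real_derivative g x) (at (x i))))"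

definition cart_hom :: "dom \<Rightarrow> dom \<Rightarrow> (vec \<Rightarrow> vec) set" where
  "cart_hom U V = {f \<in> carr U \<rightarrow>\<^sub>E carr V. \<forall>k. \<forall>i<fst V. Ck k U (\<lambda>x. f x i)}"

definition diffeomorphic :: "dom \<Rightarrow> dom \<Rightarrow> bool" where
  "diffeomorphic U V \<longleftrightarrow>
     (\<exists>f\<in>cart_hom U V. \<exists>g\<in>cart_hom V U.
        (\<forall>x\<in>carr U. g (f x) = x) \<and> (\<forall>y\<in>carr V. f (g y) = y))"

text \<open>The small model of the category of cartesian spaces: all open subsets of some \<open>\<real>\<^sup>n\<close>
  diffeomorphic to some \<open>\<real>\<^sup>m\<close>, with all smooth maps between them.  It contains every \<open>\<real>\<^sup>n\<close> and
  is closed under passage to cartesian open subsets.\<close>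

definition Cart :: "dom set" where
  "Cart = {U. open_dom U \<and> (\<exists>m. diffeomorphic U (m, topspace (Euclidean_space m)))}"

definition good_cover :: "dom \<Rightarrow> vec set set \<Rightarrow> bool" where
  "good_cover U \<V> \<longleftrightarrow>
     \<Union>\<V> = carr U \<and> (\<forall>V\<in>\<V>. (fst U, V) \<in> Cart) \<and>
     (\<forall>\<F>. \<F> \<subseteq> \<V> \<and> finite \<F> \<and> \<F> \<noteq> {} \<and> \<Inter>\<F> \<noteq> {} \<longrightarrow> (fst U, \<Inter>\<F>) \<in> Cart)"

section \<open>Diffeological spaces\<close>

text \<open>Plots are extensional functions, so that distinct plots are distinct as functions on their
  domain; this matters where plots serve as indices.\<close>

record 'x diffeology =
  points :: "'x set"
  plots :: "dom \<Rightarrow> (vec \<Rightarrow> 'x) set"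

definition diffeological_space :: "'x diffeology \<Rightarrow> bool" where
  "diffeological_space X \<longleftrightarrow>
     (\<forall>U\<in>Cart. plots X U \<subseteq> carr U \<rightarrow>\<^sub>E points X) \<and>
     (let R0 = (0, topspace (Euclidean_space 0)) in carr R0 \<rightarrow>\<^sub>E points X \<subseteq> plots X R0) \<and>
     (\<forall>U\<in>Cart. \<forall>V\<in>Cart. \<forall>p\<in>plots X U. \<forall>f\<in>cart_hom V U. compose (carr V) p f \<in> plots X V) \<and>
     (\<forall>U\<in>Cart. \<forall>p \<in> carr U \<rightarrow>\<^sub>E points X. \<forall>\<V>. good_cover U \<V> \<longrightarrow>
        (\<forall>V\<in>\<V>. restrict p V \<in> plots X (fst U, V)) \<longrightarrow> p \<in> plots X U)"

definition smooth :: "'x diffeology \<Rightarrow> 'y diffeology \<Rightarrow> ('x \<Rightarrow> 'y) set" where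
  "smooth X Y = {f \<in> points X \<rightarrow>\<^sub>E points Y.
     \<forall>U\<in>Cart. \<forall>p\<in>plots X U. compose (carr U) f p \<in> plots Y U}"

definition cart_diff :: "dom \<Rightarrow> vec diffeology" where
  "cart_diff U = \<lparr>points = carr U, plots = (\<lambda>W. cart_hom W U)\<rparr>"

definition sub_diff :: "'x diffeology \<Rightarrow> 'x set \<Rightarrow> 'x diffeology" where
  "sub_diff X S = \<lparr>points = points X \<inter> S, plots = (\<lambda>U. {p \<in> plots X U. p ` carr U \<subseteq> S})\<rparr>"

definition prod_diff :: "'x diffeology \<Rightarrow> 'y diffeology \<Rightarrow> ('x \<times> 'y) diffeology" where
  "prod_diff X Y =
     \<lparr>points = points X \<times> points Y,
      plots = (\<lambda>U. {p \<in> carr U \<rightarrow>\<^sub>E points X \<times> points Y.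
        (\<lambda>u\<in>carr U. fst (p u)) \<in> plots X U \<and> (\<lambda>u\<in>carr U. snd (p u)) \<in> plots Y U})\<rparr>"

text \<open>The \<open>k\<close>-fold power, with tuples as lists of length \<open>k\<close>.\<close>

definition power_diff :: "'x diffeology \<Rightarrow> nat \<Rightarrow> 'x list diffeology" where
  "power_diff X k = (let P = {xs. length xs = k \<and> set xs \<subseteq> points X} in
     \<lparr>points = P,
      plots = (\<lambda>U. {p \<in> carr U \<rightarrow>\<^sub>E P. \<forall>i<k. (\<lambda>u\<in>carr U. p u ! i) \<in> plots X U})\<rparr>)"

definition coprod_diff :: "'i set \<Rightarrow> ('i \<Rightarrow> 'x diffeology) \<Rightarrow> ('i \<times> 'x) diffeology" where
  "coprod_diff I D = (let P = Sigma I (\<lambda>i. points (D i)) in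
     \<lparr>points = P,
      plots = (\<lambda>U. {q \<in> carr U \<rightarrow>\<^sub>E P. \<exists>\<V>. good_cover U \<V> \<and>
        (\<forall>V\<in>\<V>. \<exists>i\<in>I. \<exists>r\<in>plots (D i) (fst U, V). \<forall>v\<in>V. q v = (i, r v))})\<rparr>)"

definition functional_diff :: "'x diffeology \<Rightarrow> 'y diffeology \<Rightarrow> ('x \<Rightarrow> 'y) diffeology" where
  "functional_diff X Y =
     \<lparr>points = smooth X Y,
      plots = (\<lambda>U. {p \<in> carr U \<rightarrow>\<^sub>E smooth X Y.
        (\<lambda>(u, x) \<in> carr U \<times> points X. p u x) \<in> smooth (prod_diff (cart_diff U) X) Y})\<rparr>"

section \<open>Diffeological abelian groups\<close>

text \<open>Groups follow HOL-Algebra and are written multiplicatively.\<close>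

record 'a diff_group = "'a monoid" +
  group_plots :: "dom \<Rightarrow> (vec \<Rightarrow> 'a) set"

definition group_space :: "'a diff_group \<Rightarrow> 'a diffeology" where
  "group_space A = \<lparr>points = carrier A, plots = group_plots A\<rparr>"

definition diffeological_abelian_group :: "'a diff_group \<Rightarrow> bool" where
  "diffeological_abelian_group A \<longleftrightarrow>
     comm_group A \<and> diffeological_space (group_space A) \<and>
     (\<lambda>(a, b) \<in> carrier A \<times> carrier A. a \<otimes>\<^bsub>A\<^esub> b)
       \<in> smooth (prod_diff (group_space A) (group_space A)) (group_space A) \<and>
     (\<lambda>a\<in>carrier A. inv\<^bsub>A\<^esub> a) \<in> smooth (group_space A) (group_space A)"

text \<open>The group of smooth maps into \<open>A\<close>, with pointwise operations.\<close>

definition smooth_group :: "'x diffeology \<Rightarrow> 'a diff_group \<Rightarrow> ('x \<Rightarrow> 'a) monoid" where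
  "smooth_group X A =
     \<lparr>carrier = smooth X (group_space A),
      mult = (\<lambda>f g. \<lambda>x\<in>points X. f x \<otimes>\<^bsub>A\<^esub> g x),
      one = (\<lambda>x\<in>points X. \<one>\<^bsub>A\<^esub>)\<rparr>"

section \<open>Chains of composable arrows\<close>

text \<open>A chain \<open>x \<rightarrow> \<dots> \<rightarrow> z\<close> of \<open>k\<close> composable arrows is its initial object \<open>x\<close> together with the list
  of arrows in order of traversal; the composition \<open>cmp f g\<close> is in diagrammatic order, \<open>f\<close> first.\<close>

fun chain :: "('m \<Rightarrow> 'o) \<Rightarrow> ('m \<Rightarrow> 'o) \<Rightarrow> 'o \<Rightarrow> 'm list \<Rightarrow> bool" where
  "chain src tgt x [] \<longleftrightarrow> True"
| "chain src tgt x (f # fs) \<longleftrightarrow> src f = x \<and> chain src tgt (tgt f) fs"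

definition chain_face ::
  "('m \<Rightarrow> 'o) \<Rightarrow> ('m \<Rightarrow> 'm \<Rightarrow> 'm) \<Rightarrow> nat \<Rightarrow> 'o \<times> 'm list \<Rightarrow> 'o \<times> 'm list" where
  "chain_face tgt cmp i = (\<lambda>(x, fs).
     if i = 0 then (tgt (hd fs), tl fs)
     else if i = length fs then (x, butlast fs)
     else (x, take (i - 1) fs @ [cmp (fs ! (i - 1)) (fs ! i)] @ drop (i + 1) fs))"

definition chain_degen ::
  "('m \<Rightarrow> 'o) \<Rightarrow> ('o \<Rightarrow> 'm) \<Rightarrow> nat \<Rightarrow> 'o \<times> 'm list \<Rightarrow> 'o \<times> 'm list" where
  "chain_degen tgt idn i = (\<lambda>(x, fs).
     (x, take i fs @ [idn (if i = 0 then x else tgt (fs ! (i - 1)))] @ drop i fs))"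

section \<open>Simplicial diffeological spaces and their cohomology\<close>

text \<open>\<open>face S k i\<close> and \<open>degen S k i\<close> are the operators \<open>d\<^sub>i\<close> and \<open>s\<^sub>i\<close> defined on level \<open>k\<close>.\<close>

record 's simp_diff =
  level :: "nat \<Rightarrow> 's diffeology"
  face :: "nat \<Rightarrow> nat \<Rightarrow> 's \<Rightarrow> 's"
  degen :: "nat \<Rightarrow> nat \<Rightarrow> 's \<Rightarrow> 's"

record ('o, 'm) diff_category =
  obj :: "'o diffeology"
  mor :: "'m diffeology"
  source :: "'m \<Rightarrow> 'o"
  target :: "'m \<Rightarrow> 'o"
  ident :: "'o \<Rightarrow> 'm"
  comp :: "'m \<Rightarrow> 'm \<Rightarrow> 'm"

definition nerve :: "('o, 'm) diff_category \<Rightarrow> ('o \<times> 'm list) simp_diff" where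
  "nerve \<C> =
     \<lparr>level = (\<lambda>k. sub_diff (prod_diff (obj \<C>) (power_diff (mor \<C>) k))
                     {(x, fs). chain (source \<C>) (target \<C>) x fs}),
      face = (\<lambda>k. chain_face (target \<C>) (comp \<C>)),
      degen = (\<lambda>k. chain_degen (target \<C>) (ident \<C>))\<rparr>"

text \<open>A cosimplicial abelian group is given by its groups \<open>C n\<close> and cofaces
  \<open>\<delta> n i : C n \<rightarrow> C (n + 1)\<close>.\<close>

definition differential ::
  "(nat \<Rightarrow> 'g monoid) \<Rightarrow> (nat \<Rightarrow> nat \<Rightarrow> 'g \<Rightarrow> 'g) \<Rightarrow> nat \<Rightarrow> 'g \<Rightarrow> 'g" where
  "differential C \<delta> n x =
     (\<Otimes>\<^bsub>C (Suc n)\<^esub>i\<in>{0..n + 1}. \<delta> n i x [^]\<^bsub>C (Suc n)\<^esub> ((-1 :: int) ^ i))"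

definition cohomology ::
  "(nat \<Rightarrow> 'g monoid) \<Rightarrow> (nat \<Rightarrow> nat \<Rightarrow> 'g \<Rightarrow> 'g) \<Rightarrow> nat \<Rightarrow> 'g set monoid" where
  "cohomology C \<delta> k =
     (C k)\<lparr>carrier := kernel (C k) (C (Suc k)) (differential C \<delta> k)\<rparr>
     Mod (if k = 0 then {\<one>\<^bsub>C k\<^esub>} else differential C \<delta> (k - 1) ` carrier (C (k - 1)))"

definition simp_diff_cohomology ::
  "'s simp_diff \<Rightarrow> 'a diff_group \<Rightarrow> nat \<Rightarrow> ('s \<Rightarrow> 'a) set monoid" where
  "simp_diff_cohomology S A =
     cohomology (\<lambda>n. smooth_group (level S n) A)
       (\<lambda>n i f. compose (points (level S (Suc n))) f (face S (Suc n) i))"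

section \<open>The nebula of a diffeological space\<close>

type_synonym 'x plot = "dom \<times> (vec \<Rightarrow> 'x)"

definition all_plots :: "'x diffeology \<Rightarrow> 'x plot set" where
  "all_plots X = {(U, p). U \<in> Cart \<and> p \<in> plots X U}"

definition nebula :: "'x diffeology \<Rightarrow> ('x plot \<times> vec) diffeology" where
  "nebula X = coprod_diff (all_plots X) (\<lambda>P. cart_diff (fst P))"

definition nebula_proj :: "'x plot \<times> vec \<Rightarrow> 'x" where
  "nebula_proj b = snd (fst b) (snd b)"

section \<open>The two diffeological categories\<close>

definition nebula_monoid ::
  "'x diffeology \<Rightarrow> ('x plot \<times> vec \<Rightarrow> 'x plot \<times> vec) diffeology" where
  "nebula_monoid X = sub_diff (functional_diff (nebula X) (nebula X))
     {m. \<forall>b\<in>points (nebula X). nebula_proj (m b) = nebula_proj b}"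

definition action_category ::
  "'x diffeology \<Rightarrow>
   ('x plot \<times> vec, ('x plot \<times> vec) \<times> ('x plot \<times> vec \<Rightarrow> 'x plot \<times> vec)) diff_category" where
  "action_category X =
     \<lparr>obj = nebula X,
      mor = prod_diff (nebula X) (nebula_monoid X),
      source = (\<lambda>(b, m). b),
      target = (\<lambda>(b, m). m b),
      ident = (\<lambda>b. (b, \<lambda>c\<in>points (nebula X). c)),
      comp = (\<lambda>(b, m) (b', m'). (b, compose (points (nebula X)) m' m))\<rparr>"

definition cech_groupoid ::
  "'x diffeology \<Rightarrow>
   ('x plot \<times> vec, ('x plot \<times> vec) \<times> ('x plot \<times> vec)) diff_category" where
  "cech_groupoid X =
     \<lparr>obj = nebula X,
      mor = sub_diff (prod_diff (nebula X) (nebula X)) {(b, c). nebula_proj b = nebula_proj c},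
      source = fst,
      target = snd,
      ident = (\<lambda>b. (b, b)),
      comp = (\<lambda>(b, c) (c', d). (b, d))\<rparr>"

definition H_PIZ where
  "H_PIZ k X A = simp_diff_cohomology (nerve (action_category X)) A k"

definition H_KWW where
  "H_KWW k X A = simp_diff_cohomology (nerve (cech_groupoid X)) A k"

section \<open>Simplicial presheaves on cartesian spaces\<close>

text \<open>\<open>restr Y k V U f\<close> is the restriction \<open>Y\<^sub>k(U) \<rightarrow> Y\<^sub>k(V)\<close> along \<open>f : V \<rightarrow> U\<close>; \<open>sface Y k i U\<close> and
  \<open>sdegen Y k i U\<close> are \<open>d\<^sub>i\<close> and \<open>s\<^sub>i\<close> on \<open>Y\<^sub>k(U)\<close>.\<close>

record 'y spre =
  sec :: "nat \<Rightarrow> dom \<Rightarrow> 'y set"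
  restr :: "nat \<Rightarrow> dom \<Rightarrow> dom \<Rightarrow> (vec \<Rightarrow> vec) \<Rightarrow> 'y \<Rightarrow> 'y"
  sface :: "nat \<Rightarrow> nat \<Rightarrow> dom \<Rightarrow> 'y \<Rightarrow> 'y"
  sdegen :: "nat \<Rightarrow> nat \<Rightarrow> dom \<Rightarrow> 'y \<Rightarrow> 'y"

definition spre_hom :: "'y spre \<Rightarrow> 'z spre \<Rightarrow> (nat \<Rightarrow> dom \<Rightarrow> 'y \<Rightarrow> 'z) set" where
  "spre_hom Y Z = {\<phi>.
     (\<forall>k. \<phi> k \<in> (\<Pi>\<^sub>E U\<in>Cart. sec Y k U \<rightarrow>\<^sub>E sec Z k U)) \<and>
     (\<forall>k. \<forall>U\<in>Cart. \<forall>V\<in>Cart. \<forall>f\<in>cart_hom V U. \<forall>y\<in>sec Y k U.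
        \<phi> k V (restr Y k V U f y) = restr Z k V U f (\<phi> k U y)) \<and>
     (\<forall>k. \<forall>U\<in>Cart. \<forall>i\<le>Suc k. \<forall>y\<in>sec Y (Suc k) U.
        \<phi> k U (sface Y (Suc k) i U y) = sface Z (Suc k) i U (\<phi> (Suc k) U y)) \<and>
     (\<forall>k. \<forall>U\<in>Cart. \<forall>i\<le>k. \<forall>y\<in>sec Y k U.
        \<phi> (Suc k) U (sdegen Y k i U y) = sdegen Z k i U (\<phi> k U y))}"

text \<open>The standard simplex \<open>\<Delta>\<^sup>n\<close>: a \<open>k\<close>-simplex is a monotone map \<open>[k] \<rightarrow> [n]\<close>, given as the list of
  its \<open>k + 1\<close> values.\<close>

definition std_simplex :: "nat \<Rightarrow> nat \<Rightarrow> nat list set" where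
  "std_simplex n k = {s. length s = Suc k \<and> sorted s \<and> set s \<subseteq> {..n}}"

definition times_simplex :: "'y spre \<Rightarrow> nat \<Rightarrow> ('y \<times> nat list) spre" where
  "times_simplex Y n =
     \<lparr>sec = (\<lambda>k U. sec Y k U \<times> std_simplex n k),
      restr = (\<lambda>k V U f (y, s). (restr Y k V U f y, s)),
      sface = (\<lambda>k i U (y, s). (sface Y k i U y, take i s @ drop (Suc i) s)),
      sdegen = (\<lambda>k i U (y, s). (sdegen Y k i U y, take (Suc i) s @ drop i s))\<rparr>"

text \<open>The set of \<open>n\<close>-simplices of the simplicial mapping space, and its operator
  \<open>Map\<^sub>n \<rightarrow> Map\<^sub>m\<close> induced by a monotone map \<open>\<theta> : [m] \<rightarrow> [n]\<close>.\<close>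

definition map_space :: "'y spre \<Rightarrow> 'z spre \<Rightarrow> nat \<Rightarrow> (nat \<Rightarrow> dom \<Rightarrow> 'y \<times> nat list \<Rightarrow> 'z) set" where
  "map_space Y Z n = spre_hom (times_simplex Y n) Z"

definition map_space_op ::
  "'y spre \<Rightarrow> nat \<Rightarrow> (nat \<Rightarrow> nat) \<Rightarrow>
   (nat \<Rightarrow> dom \<Rightarrow> 'y \<times> nat list \<Rightarrow> 'z) \<Rightarrow> (nat \<Rightarrow> dom \<Rightarrow> 'y \<times> nat list \<Rightarrow> 'z)" where
  "map_space_op Y m \<theta> \<phi> =
     (\<lambda>k. \<lambda>U\<in>Cart. \<lambda>(y, s) \<in> sec (times_simplex Y m) k U. \<phi> k U (y, map \<theta> s))"

definition coface :: "nat \<Rightarrow> nat \<Rightarrow> nat" where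
  "coface j i = (if i < j then i else Suc i)"

text \<open>The equivalence relation on vertices generated by the edges, whose classes form \<open>\<pi>\<^sub>0\<close>.\<close>

definition pi0_rel ::
  "'y spre \<Rightarrow> 'z spre \<Rightarrow>
   ((nat \<Rightarrow> dom \<Rightarrow> 'y \<times> nat list \<Rightarrow> 'z) \<times> (nat \<Rightarrow> dom \<Rightarrow> 'y \<times> nat list \<Rightarrow> 'z)) set" where
  "pi0_rel Y Z =
     (let E = {(map_space_op Y 0 (coface 1) e, map_space_op Y 0 (coface 0) e) | e.
                 e \<in> map_space Y Z 1}
      in (E \<union> E\<inverse>)\<^sup>* \<inter> map_space Y Z 0 \<times> map_space Y Z 0)"

section \<open>The infinity cohomology in degree zero\<close>

text \<open>\<open>A\<close> as a discrete (simplicially constant) simplicial presheaf.\<close>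

definition group_spre :: "'a diff_group \<Rightarrow> (vec \<Rightarrow> 'a) spre" where
  "group_spre A =
     \<lparr>sec = (\<lambda>k U. smooth (cart_diff U) (group_space A)),
      restr = (\<lambda>k V U f g. compose (carr V) g f),
      sface = (\<lambda>k i U g. g),
      sdegen = (\<lambda>k i U g. g)\<rparr>"

text \<open>A map of plots is a triple (source plot, map, target plot).\<close>

type_synonym 'x plot_map = "'x plot \<times> (vec \<Rightarrow> vec) \<times> 'x plot"

definition plot_maps :: "'x diffeology \<Rightarrow> 'x plot_map set" where
  "plot_maps X = {(P, f, Q). P \<in> all_plots X \<and> Q \<in> all_plots X \<and>
     f \<in> cart_hom (fst P) (fst Q) \<and> compose (carr (fst P)) (snd Q) f = snd P}"

abbreviation plot_src :: "'x plot_map \<Rightarrow> 'x plot" where "plot_src \<equiv> \<lambda>(P, f, Q). P"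
abbreviation plot_fun :: "'x plot_map \<Rightarrow> vec \<Rightarrow> vec" where "plot_fun \<equiv> \<lambda>(P, f, Q). f"
abbreviation plot_tgt :: "'x plot_map \<Rightarrow> 'x plot" where "plot_tgt \<equiv> \<lambda>(P, f, Q). Q"

definition plot_comp :: "'x plot_map \<Rightarrow> 'x plot_map \<Rightarrow> 'x plot_map" where
  "plot_comp = (\<lambda>(P, f, Q) (Q', g, R). (P, compose (carr (fst P)) g f, R))"

definition plot_ident :: "'x plot \<Rightarrow> 'x plot_map" where
  "plot_ident P = (P, (\<lambda>x\<in>carr (fst P). x), P)"

text \<open>\<open>QX\<close> as a simplicial presheaf.  A section over \<open>U\<close> in simplicial degree \<open>k\<close> is
  \<open>((p\<^sub>k, [f\<^sub>k\<^sub>-\<^sub>1, \<dots>, f\<^sub>0]), h)\<close> with \<open>h : U \<rightarrow> U\<^bsub>p\<^sub>k\<^esub>\<close> smooth, i.e. a section of the coproduct over all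
  chains of the presheaves represented by the \<open>U\<^bsub>p\<^sub>k\<^esub>\<close>.\<close>

definition QX :: "'x diffeology \<Rightarrow> (('x plot \<times> 'x plot_map list) \<times> (vec \<Rightarrow> vec)) spre" where
  "QX X =
     \<lparr>sec = (\<lambda>k U. {((P, as), h). P \<in> all_plots X \<and> length as = k \<and> set as \<subseteq> plot_maps X \<and>
                chain plot_src plot_tgt P as \<and> h \<in> cart_hom U (fst P)}),
      restr = (\<lambda>k V U f (c, h). (c, compose (carr V) h f)),
      sface = (\<lambda>k i U (c, h). (chain_face plot_tgt plot_comp i c,
                if i = 0 then compose (carr U) (plot_fun (hd (snd c))) h else h)),
      sdegen = (\<lambda>k i U (c, h). (chain_degen plot_tgt plot_ident i c, h))\<rparr>"

text \<open>The group structure on \<open>\<pi>\<^sub>0\<close> is induced by the pointwise one on vertices.\<close>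

definition H0_inf ::
  "'x diffeology \<Rightarrow> 'a diff_group \<Rightarrow>
   (nat \<Rightarrow> dom \<Rightarrow> (('x plot \<times> 'x plot_map list) \<times> (vec \<Rightarrow> vec)) \<times> nat list \<Rightarrow> vec \<Rightarrow> 'a) set monoid"
where
  "H0_inf X A =
     (let R = pi0_rel (QX X) (group_spre A);
          S = (\<lambda>k U. sec (times_simplex (QX X) 0) k U);
          plus = (\<lambda>\<phi> \<psi> k. \<lambda>U\<in>Cart. \<lambda>z\<in>S k U. \<phi> k U z \<otimes>\<^bsub>smooth_group (cart_diff U) A\<^esub> \<psi> k U z);
          zero = (\<lambda>k. \<lambda>U\<in>Cart. \<lambda>z\<in>S k U. \<one>\<^bsub>smooth_group (cart_diff U) A\<^esub>)
      in \<lparr>carrier = map_space (QX X) (group_spre A) 0 // R,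
          mult = (\<lambda>P Q. \<Union>\<phi>\<in>P. \<Union>\<psi>\<in>Q. R `` {plus \<phi> \<psi>}),
          one = R `` {zero}\<rparr>)"

end

theory Submission
  imports Defs
begin

text \<open>
  Each of the three cohomology groups is the group of smooth maps from the nebula to \<open>A\<close> satisfying a
  cocycle condition, and in each case the condition says that the map is constant on the fibres of the
  projection \<open>\<pi>\<close> to \<open>X\<close>.  It suffices to compare a point of the nebula over \<open>x\<close> with the single point of
  the component indexed by the constant plot \<open>\<real>\<^sup>0 \<rightarrow> X\<close> at \<open>x\<close>.  The Cech groupoid has an arrow between
  these two points, there is a map of plots between their components, and there is an element of \<open>M\<close>
  which moves only that component.  A map constant on the fibres descends to a smooth map on \<open>X\<close>, since
  each plot \<open>p\<close> factors as \<open>\<pi>\<close> after the inclusion of its own component.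
\<close>

section \<open>Smooth maps between open subsets of Euclidean spaces\<close>

text \<open>The detour over constant plots on R^0 avoids an obstacle. An element of M acts on whole
  components and has to respect the projection on all of each, so carrying one point of a fibre to
  another would mean factoring one plot through another, which is impossible in general; maps of
  plots meet the same difficulty. A component with a single point imposes no such condition. In
  degree zero neither quotient identifies anything: the coboundaries are trivial, and since the
  presheaf of \<open>A\<close> is discrete, the two ends of an edge of the mapping space coincide.
  All classes are therefore singletons. Smoothness is given by iterated partial derivatives, whereas
  sections of \<open>QX\<close> are moved along composites of smooth maps; hence the chain rule is
  established at the start, in coordinates.\<close>

abbreviation dom_topology :: "dom \<Rightarrow> vec topology" where
  "dom_topology U \<equiv> subtopology (Euclidean_space (fst U)) (carr U)"

lemma open_dom_subset: "open_dom U \<Longrightarrow> carr U \<subseteq> topspace (Euclidean_space (fst U))"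
  by (simp add: open_dom_def openin_subset)

lemma topspace_dom_topology: "open_dom U \<Longrightarrow> topspace (dom_topology U) = carr U"
  using open_dom_subset by fastforce

text \<open>The topology is that of a subspace of the product over all indices. Only the first
  \<open>n\<close> factors of a basic open set constrain anything, because points of R^n agree,
  being zero, in all later coordinates.\<close>

lemma open_Euclidean_space_box:
  assumes "openin (Euclidean_space n) S" and "x \<in> S"
  obtains \<delta> where "\<delta> > 0"
    and "\<And>y. y \<in> topspace (Euclidean_space n) \<Longrightarrow> (\<forall>i<n. \<bar>y i - x i\<bar> < \<delta>) \<Longrightarrow> y \<in> S"
proof -
  obtain T where T: "openin (powertop_real UNIV) T" "S = T \<inter> {x. \<forall>i\<ge>n. x i = 0}"
    using assms(1) unfolding Euclidean_space_def openin_subtopology by blast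
  then have "x \<in> T" using assms(2) by blast
  obtain B where B: "x \<in> Pi\<^sub>E UNIV B" "\<And>i. open (B i)" "Pi\<^sub>E UNIV B \<subseteq> T"
    using product_topology_open_contains_basis[OF T(1) \<open>x \<in> T\<close>] by auto
  \<comment> \<open>As statements about all small \<open>d\<close>, the conditions for the finitely
    many coordinates combine without taking a minimum.\<close>
  have "\<forall>\<^sub>F d in at_right (0::real). ball (x i) d \<subseteq> B i" for i
  proof -
    obtain e where "e > 0" "ball (x i) e \<subseteq> B i"
      using B(1,2) open_contains_ball by blast
    then have "\<forall>d>0. d < e \<longrightarrow> ball (x i) d \<subseteq> B i" by auto
    then show ?thesis using \<open>e > 0\<close> by (auto simp: eventually_at_right_field)
  qed
  then have "\<forall>\<^sub>F d in at_right (0::real). \<forall>i\<in>{..<n}. ball (x i) d \<subseteq> B i"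
    by (simp add: eventually_ball_finite)
  then obtain e :: real where e: "e > 0" "\<And>d. 0 < d \<Longrightarrow> d < e \<Longrightarrow> \<forall>i\<in>{..<n}. ball (x i) d \<subseteq> B i"
    by (auto simp: eventually_at_right_field)
  show ?thesis
  proof
    \<comment> \<open>The bound \<open>d < e\<close> is strict, so half of \<open>e\<close> serves
      as the radius.\<close>
    show "e / 2 > 0" using e(1) by simp
    fix y assume y: "y \<in> topspace (Euclidean_space n)" "\<forall>i<n. \<bar>y i - x i\<bar> < e / 2"
    have "y i \<in> B i" for i
    proof (cases "i < n")
      case True
      then have "y i \<in> ball (x i) (e / 2)" using y(2) by (auto simp: dist_real_def abs_minus_commute)
      moreover have "ball (x i) (e / 2) \<subseteq> B i" using e(2)[of "e / 2"] e(1) True by simp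
      ultimately show ?thesis by blast
    next
      case False
      then have "y i = x i" using y(1) assms(2) T(2) by (auto simp: topspace_Euclidean_space)
      then show ?thesis using B(1) by auto
    qed
    then show "y \<in> S" using B(3) y(1) T(2) by (auto simp: topspace_Euclidean_space)
  qed
qed

text \<open>A partial derivative looks only at the line \<open>x(i := t)\<close>. Near
  \<open>x\<close> this line stays inside the open set, so values outside the set do not influence
  derivatives.\<close>

lemma eventually_update_in_dom:
  assumes "open_dom U" "x \<in> carr U" "i < fst U"
  shows "\<forall>\<^sub>F t in nhds (x i). x(i := t) \<in> carr U"
proof -
  obtain \<delta> where \<delta>: "\<delta> > 0"
    "\<And>y. y \<in> topspace (Euclidean_space (fst U)) \<Longrightarrow> (\<forall>i<fst U. \<bar>y i - x i\<bar> < \<delta>) \<Longrightarrow> y \<in> carr U"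
    using open_Euclidean_space_box assms unfolding open_dom_def by metis
  have "x \<in> topspace (Euclidean_space (fst U))" using assms open_dom_subset by blast
  then have "dist t (x i) < \<delta> \<Longrightarrow> x(i := t) \<in> carr U" for t
    using \<delta> assms(3) by (auto simp: topspace_Euclidean_space dist_real_def)
  then show ?thesis using \<delta>(1) eventually_nhds_metric by blast
qed

section \<open>Closure properties of the classes \<open>Ck k\<close>\<close>

lemma Ck_continuous: "Ck k U f \<Longrightarrow> continuous_map (dom_topology U) euclideanreal f"
  by (cases k) auto

lemma Ck_antimono: "Ck (Suc k) U f \<Longrightarrow> Ck k U f"
proof (induction k arbitrary: f)
  case (Suc k)
  then have "\<exists>g. Ck k U g \<and> (\<forall>x\<in>carr U. ((\<lambda>t. f (x(i := t))) has_real_derivative g x) (at (x i)))"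
    if "i < fst U" for i
    using that Ck.simps(2)[of "Suc k" U f] by blast
  then show ?case using Suc.prems by simp
qed simp

text \<open>Elements of \<open>cart_hom\<close> are extensional, so a natural formula has to be
  exchanged for a function that is changed off \<open>U\<close>. Derivatives survive because,
  \<open>U\<close> being open, both functions agree on each coordinate line near its base
  point.\<close>

lemma Ck_cong:
  assumes "open_dom U" "Ck k U f" "\<And>x. x \<in> carr U \<Longrightarrow> f x = g x"
  shows "Ck k U g"
proof -
  have cont: "continuous_map (dom_topology U) euclideanreal g"
    by (rule continuous_map_eq[OF Ck_continuous[OF assms(2)]])
      (use assms(3) topspace_dom_topology[OF assms(1)] in blast)
  show ?thesis
  proof (cases k)
    case (Suc l)
    have "\<exists>g'. Ck l U g' \<and> (\<forall>x\<in>carr U. ((\<lambda>t. g (x(i := t))) has_real_derivative g' x) (at (x i)))"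
      if i: "i < fst U" for i
    proof -
      obtain g' where g': "Ck l U g'"
        "\<And>x. x \<in> carr U \<Longrightarrow> ((\<lambda>t. f (x(i := t))) has_real_derivative g' x) (at (x i))"
        using assms(2) Suc i by auto
      have "((\<lambda>t. g (x(i := t))) has_real_derivative g' x) (at (x i))" if "x \<in> carr U" for x
      proof -
        have "\<forall>\<^sub>F t in nhds (x i). f (x(i := t)) = g (x(i := t))"
          using eventually_update_in_dom[OF assms(1) that i] by eventually_elim (rule assms(3))
        then show ?thesis using iffD1[OF DERIV_cong_ev[OF refl _ refl] g'(2)[OF that]] by simp
      qed
      then show ?thesis using g'(1) by blast
    qed
    then show ?thesis using cont Suc by simp
  qed (use cont in simp)
qed

lemma Ck_const: "Ck k U (\<lambda>x. c)"
proof (induction k arbitrary: c)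
  case (Suc k)
  have "\<exists>g. Ck k U g \<and> (\<forall>x\<in>carr U. ((\<lambda>t. c) has_real_derivative g x) (at (x i)))" for i
    by (rule exI[of _ "\<lambda>x. 0"]) (simp add: Suc)
  then show ?case by simp
qed simp

lemma Ck_coordinate: "Ck k U (\<lambda>x. x i)"
proof -
  have cont: "continuous_map (dom_topology U) euclideanreal (\<lambda>x. x i)"
    unfolding Euclidean_space_def
    by (intro continuous_map_from_subtopology continuous_map_product_projection) simp
  show ?thesis
  proof (cases k)
    case (Suc l)
    have "\<exists>g. Ck l U g \<and> (\<forall>x\<in>carr U. ((\<lambda>t. (x(j := t)) i) has_real_derivative g x) (at (x j)))" for j
      by (cases "i = j") (rule exI[of _ "\<lambda>x. if i = j then 1 else 0"], auto simp: Ck_const)+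
    then show ?thesis using cont Suc by simp
  qed (use cont in simp)
qed

lemma Ck_add: "Ck k U f \<Longrightarrow> Ck k U g \<Longrightarrow> Ck k U (\<lambda>x. f x + g x)"
proof (induction k arbitrary: f g)
  case (Suc k)
  have "\<exists>h. Ck k U h \<and>
      (\<forall>x\<in>carr U. ((\<lambda>t. f (x(i := t)) + g (x(i := t))) has_real_derivative h x) (at (x i)))"
    if i: "i < fst U" for i
  proof -
    obtain f' g' where "Ck k U f'" "Ck k U g'"
      "\<And>x. x \<in> carr U \<Longrightarrow> ((\<lambda>t. f (x(i := t))) has_real_derivative f' x) (at (x i))"
      "\<And>x. x \<in> carr U \<Longrightarrow> ((\<lambda>t. g (x(i := t))) has_real_derivative g' x) (at (x i))"
      using Suc.prems i by (simp only: Ck.simps) metis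
    then show ?thesis
      by (intro exI[of _ "\<lambda>x. f' x + g' x"]) (auto intro!: Suc.IH DERIV_add)
  qed
  then show ?case using Suc.prems by (simp add: continuous_map_add)
qed (simp add: continuous_map_add)

lemma Ck_sum:
  fixes f :: "'i \<Rightarrow> vec \<Rightarrow> real"
  assumes "\<And>i. i \<in> I \<Longrightarrow> Ck k U (f i)"
  shows "Ck k U (\<lambda>x. \<Sum>i\<in>I. f i x)"
  using assms by (induction I rule: infinite_finite_induct) (auto intro: Ck_const Ck_add)

lemma Ck_mult: "Ck k U f \<Longrightarrow> Ck k U g \<Longrightarrow> Ck k U (\<lambda>x. f x * g x)"
proof (induction k arbitrary: f g)
  case (Suc k)
  have "\<exists>h. Ck k U h \<and>
      (\<forall>x\<in>carr U. ((\<lambda>t. f (x(i := t)) * g (x(i := t))) has_real_derivative h x) (at (x i)))"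
    if i: "i < fst U" for i
  proof -
    obtain f' g' where 1: "Ck k U f'" "Ck k U g'"
      "\<And>x. x \<in> carr U \<Longrightarrow> ((\<lambda>t. f (x(i := t))) has_real_derivative f' x) (at (x i))"
      "\<And>x. x \<in> carr U \<Longrightarrow> ((\<lambda>t. g (x(i := t))) has_real_derivative g' x) (at (x i))"
      using Suc.prems i by (simp only: Ck.simps) metis
    \<comment> \<open>The product rule returns \<open>f\<close> and \<open>g\<close> themselves,
      which are first weakened to order \<open>k\<close> for the induction hypothesis.\<close>
    have "Ck k U (\<lambda>x. f' x * g x + g' x * f x)"
      by (intro Ck_add Suc.IH 1 Suc.prems[THEN Ck_antimono])
    moreover have "((\<lambda>t. f (x(i := t)) * g (x(i := t))) has_real_derivative f' x * g x + g' x * f x) (at (x i))"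
      if "x \<in> carr U" for x
      using DERIV_mult[OF 1(3)[OF that] 1(4)[OF that]] by simp
    ultimately show ?thesis by blast
  qed
  then show ?case using Suc.prems by (simp add: continuous_map_real_mult)
qed (simp add: continuous_map_real_mult)

text \<open>Change the coordinates from \<open>x\<close> to \<open>y\<close> one at a time and
  apply the mean value theorem to each step.\<close>

lemma C1_caratheodory:
  assumes V: "open_dom V" and x: "x \<in> carr V"
    and g: "\<And>i. i < fst V \<Longrightarrow> continuous_map (dom_topology V) euclideanreal (g i)"
    and f: "\<And>i x. i < fst V \<Longrightarrow> x \<in> carr V \<Longrightarrow>
              ((\<lambda>t. f (x(i := t))) has_real_derivative g i x) (at (x i))"
  shows "\<exists>c. (\<forall>y\<in>topspace (Euclidean_space (fst V)). f y - f x = (\<Sum>i<fst V. c i y * (y i - x i))) \<and>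
    (\<forall>i<fst V. \<forall>\<epsilon>>0. \<exists>\<delta>>0. \<forall>y\<in>topspace (Euclidean_space (fst V)).
       (\<forall>j<fst V. \<bar>y j - x j\<bar> < \<delta>) \<longrightarrow> \<bar>c i y - g i x\<bar> < \<epsilon>)"
proof -
  let ?E = "topspace (Euclidean_space (fst V))"
  \<comment> \<open>The corners of the path from \<open>x\<close> to \<open>y\<close> that changes
    one coordinate at a time.\<close>
  define z where "z j y = (\<lambda>i. if i < j then y i else x i)" for j :: nat and y :: vec
  \<comment> \<open>The difference quotient over the \<open>i\<close>-th leg of the path; a leg of
    length zero is given the value that the quotient should approach.\<close>
  define c where "c i y = (if y i = x i then g i x else (f (z (Suc i) y) - f (z i y)) / (y i - x i))" for i y
  have xE: "x \<in> ?E" using V x open_dom_subset by blast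
  have step: "z (Suc i) y = (z i y)(i := y i)" for i y by (auto simp: z_def)
  show ?thesis
  proof (rule exI[of _ c], intro conjI ballI allI impI)
    fix y assume y: "y \<in> ?E"
    have z0: "z 0 y = x" by (simp add: z_def)
    have zn: "z (fst V) y = y" using y xE by (auto simp: z_def topspace_Euclidean_space)
    \<comment> \<open>Pure algebra, valid also when the corners leave \<open>V\<close>;
      differentiability enters only in the estimate near \<open>x\<close>.\<close>
    have "c i y * (y i - x i) = f (z (Suc i) y) - f (z i y)" for i
    proof (cases "y i = x i")
      case True
      then have "z (Suc i) y = z i y" by (auto simp: z_def less_Suc_eq)
      then show ?thesis using True by simp
    qed (simp add: c_def)
    then show "f y - f x = (\<Sum>i<fst V. c i y * (y i - x i))"
      using sum_lessThan_telescope[of "\<lambda>i. f (z i y)" "fst V"] z0 zn by simp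
  next
    fix i and \<epsilon> :: real
    assume i: "i < fst V" and \<epsilon>: "\<epsilon> > 0"
    have "openin (dom_topology V) {y \<in> topspace (dom_topology V). g i y \<in> ball (g i x) \<epsilon>}"
      by (rule openin_continuous_map_preimage[OF g[OF i]]) auto
    then have "openin (Euclidean_space (fst V)) {y \<in> carr V. g i y \<in> ball (g i x) \<epsilon>}"
      using V topspace_dom_topology[OF V] openin_trans_full unfolding open_dom_def by metis
    then obtain \<delta> where \<delta>: "\<delta> > 0"
      "\<And>y. y \<in> ?E \<Longrightarrow> \<forall>j<fst V. \<bar>y j - x j\<bar> < \<delta> \<Longrightarrow> y \<in> {y \<in> carr V. g i y \<in> ball (g i x) \<epsilon>}"
      using x \<epsilon> by (elim open_Euclidean_space_box) auto
    have "\<bar>c i y - g i x\<bar> < \<epsilon>" if y: "y \<in> ?E" "\<forall>j<fst V. \<bar>y j - x j\<bar> < \<delta>" for y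
    proof (cases "y i = x i")
      case False
      \<comment> \<open>The line carrying the \<open>i\<close>-th leg. Each coordinate of
        \<open>w t\<close> comes from \<open>x\<close>, from \<open>y\<close> or is
        \<open>t\<close>, so the point stays in the box around \<open>x\<close> while
        \<open>t\<close> is close to \<open>x i\<close>.\<close>
      define w where "w t = (z i y)(i := t)" for t
      have w: "w t \<in> carr V \<and> g i (w t) \<in> ball (g i x) \<epsilon>" if t: "\<bar>t - x i\<bar> < \<delta>" for t
      proof -
        have "w t \<in> ?E" using y xE i by (auto simp: w_def z_def topspace_Euclidean_space)
        moreover have "\<forall>j<fst V. \<bar>w t j - x j\<bar> < \<delta>" using y t \<delta>(1) by (auto simp: w_def z_def)
        ultimately show ?thesis using \<delta>(2) by blast
      qed
      have d: "((\<lambda>t. f (w t)) has_real_derivative g i (w t)) (at t)" if t: "\<bar>t - x i\<bar> < \<delta>" for t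
        using f[OF i conjunct1[OF w[OF t]]] by (simp add: w_def)
      have yi: "\<bar>y i - x i\<bar> < \<delta>" using y i by blast
      have "\<exists>t. \<bar>t - x i\<bar> < \<delta> \<and> f (w (y i)) - f (w (x i)) = (y i - x i) * g i (w t)"
      proof (cases "x i < y i")
        case True
        have "\<exists>t>x i. t < y i \<and> f (w (y i)) - f (w (x i)) = (y i - x i) * g i (w t)"
          by (rule MVT2[OF True]) (use yi in \<open>auto intro!: d\<close>)
        then show ?thesis using yi by force
      next
        case False
        then have lt: "y i < x i" using \<open>y i \<noteq> x i\<close> by simp
        have "\<exists>t>y i. t < x i \<and> f (w (x i)) - f (w (y i)) = (x i - y i) * g i (w t)"
          by (rule MVT2[OF lt]) (use yi in \<open>auto intro!: d\<close>)
        then obtain t where "y i < t" "t < x i" "f (w (x i)) - f (w (y i)) = (x i - y i) * g i (w t)"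
          by blast
        then show ?thesis using yi by (intro exI[of _ t]) (auto simp: algebra_simps)
      qed
      then obtain t where t: "\<bar>t - x i\<bar> < \<delta>" "f (w (y i)) - f (w (x i)) = (y i - x i) * g i (w t)"
        by blast
      have "w (x i) = z i y" by (auto simp: w_def z_def)
      then have "c i y = g i (w t)" using t False by (simp add: c_def step w_def)
      then show ?thesis using w[OF t(1)] by (simp add: dist_real_def abs_minus_commute)
    qed (use \<epsilon> in \<open>simp add: c_def\<close>)
    then show "\<exists>\<delta>>0. \<forall>y\<in>?E. (\<forall>j<fst V. \<bar>y j - x j\<bar> < \<delta>) \<longrightarrow> \<bar>c i y - g i x\<bar> < \<epsilon>"
      using \<delta>(1) by blast
  qed
qed

text \<open>R^n sits in the space of all sequences, whose product topology comes from no norm, so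
  the chain rule is proved along curves instead of through a total derivative: the identity of
  \<open>C1_caratheodory\<close> is divided by \<open>s - t\<close>, and each term has a
  limit.\<close>

lemma chain_rule_along_curve:
  fixes \<gamma> :: "real \<Rightarrow> vec"
  assumes V: "open_dom V" and x: "\<gamma> t \<in> carr V"
    and g: "\<And>i. i < fst V \<Longrightarrow> continuous_map (dom_topology V) euclideanreal (g i)"
    and f: "\<And>i x. i < fst V \<Longrightarrow> x \<in> carr V \<Longrightarrow>
              ((\<lambda>t. f (x(i := t))) has_real_derivative g i x) (at (x i))"
    and \<gamma>: "\<And>i. i < fst V \<Longrightarrow> ((\<lambda>s. \<gamma> s i) has_real_derivative d i) (at t)"
    and ev: "\<forall>\<^sub>F s in at t. \<gamma> s \<in> carr V"
  shows "((\<lambda>s. f (\<gamma> s)) has_real_derivative (\<Sum>i<fst V. g i (\<gamma> t) * d i)) (at t)"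
proof -
  let ?E = "topspace (Euclidean_space (fst V))"
  obtain c where c: "\<And>y. y \<in> ?E \<Longrightarrow> f y - f (\<gamma> t) = (\<Sum>i<fst V. c i y * (y i - \<gamma> t i))"
    "\<And>i \<epsilon>. i < fst V \<Longrightarrow> \<epsilon> > 0 \<Longrightarrow> \<exists>\<delta>>0. \<forall>y\<in>?E. (\<forall>j<fst V. \<bar>y j - \<gamma> t j\<bar> < \<delta>) \<longrightarrow> \<bar>c i y - g i (\<gamma> t)\<bar> < \<epsilon>"
    using C1_caratheodory[of V "\<gamma> t" g f, OF V x g f] by blast
  have evE: "\<forall>\<^sub>F s in at t. \<gamma> s \<in> ?E"
    by (rule eventually_mono[OF ev]) (use open_dom_subset[OF V] in blast)
  have lim: "((\<lambda>s. c i (\<gamma> s)) \<longlongrightarrow> g i (\<gamma> t)) (at t)" if i: "i < fst V" for i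
  proof (rule tendstoI)
    fix \<epsilon> :: real assume "\<epsilon> > 0"
    then obtain \<delta> where \<delta>: "\<delta> > 0"
      "\<And>y. y\<in>?E \<Longrightarrow> (\<forall>j<fst V. \<bar>y j - \<gamma> t j\<bar> < \<delta>) \<Longrightarrow> \<bar>c i y - g i (\<gamma> t)\<bar> < \<epsilon>"
      using c(2)[OF i \<open>\<epsilon> > 0\<close>] by blast
    have "\<forall>\<^sub>F s in at t. \<bar>\<gamma> s j - \<gamma> t j\<bar> < \<delta>" if "j < fst V" for j
      using tendstoD[OF isContD[OF DERIV_isCont[OF \<gamma>[OF that]]] \<delta>(1)] by (simp add: dist_real_def)
    then have "\<forall>\<^sub>F s in at t. \<forall>j\<in>{..<fst V}. \<bar>\<gamma> s j - \<gamma> t j\<bar> < \<delta>"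
      by (simp add: eventually_ball_finite)
    then show "\<forall>\<^sub>F s in at t. dist (c i (\<gamma> s)) (g i (\<gamma> t)) < \<epsilon>"
      using evE by eventually_elim (use \<delta>(2) in \<open>auto simp: dist_real_def\<close>)
  qed
  have "((\<lambda>s. \<Sum>i<fst V. c i (\<gamma> s) * ((\<gamma> s i - \<gamma> t i) / (s - t))) \<longlongrightarrow> (\<Sum>i<fst V. g i (\<gamma> t) * d i)) (at t)"
    using \<gamma> lim by (intro tendsto_intros) (auto simp: has_field_derivative_iff)
  moreover have "\<forall>\<^sub>F s in at t. (\<Sum>i<fst V. c i (\<gamma> s) * ((\<gamma> s i - \<gamma> t i) / (s - t))) = (f (\<gamma> s) - f (\<gamma> t)) / (s - t)"
    using evE by eventually_elim (simp add: c(1) sum_divide_distrib)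
  ultimately show ?thesis
    unfolding has_field_derivative_iff using tendsto_cong by force
qed

text \<open>Induction on the order with \<open>f\<close> general: a partial derivative of the
  composite is a sum of products. The factors are partial derivatives of \<open>f\<close> after
  \<open>h\<close>, covered by the induction hypothesis, and partial derivatives of
  \<open>h\<close>.\<close>

lemma Ck_compose:
  assumes U: "open_dom U" and V: "open_dom V"
    and h: "\<And>x. x \<in> carr U \<Longrightarrow> h x \<in> carr V" "\<And>i. i < fst V \<Longrightarrow> Ck k U (\<lambda>x. h x i)"
    and f: "Ck k V f"
  shows "Ck k U (\<lambda>x. f (h x))"
  using h(2) f
proof (induction k arbitrary: f)
  case 0
  \<comment> \<open>The hypothesis concerns the first \<open>fst V\<close> coordinates only. Filling
    the others with zero gives a continuous map into R^n that equals \<open>h\<close> on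
    \<open>U\<close>.\<close>
  have "continuous_map (dom_topology U) (Euclidean_space (fst V)) (\<lambda>x i. if i < fst V then h x i else 0)"
    using 0(1) by (simp add: continuous_map_componentwise_Euclidean_space)
  moreover have "(\<lambda>i. if i < fst V then h x i else 0) = h x" if "x \<in> topspace (dom_topology U)" for x
  proof -
    have "h x \<in> topspace (Euclidean_space (fst V))"
      using h(1) that open_dom_subset[OF V] topspace_dom_topology[OF U] by blast
    then show ?thesis by (auto simp: topspace_Euclidean_space fun_eq_iff)
  qed
  ultimately have "continuous_map (dom_topology U) (Euclidean_space (fst V)) h"
    by (rule continuous_map_eq)
  then have "continuous_map (dom_topology U) (dom_topology V) h"
    using h(1) topspace_dom_topology[OF U] by (auto simp: continuous_map_in_subtopology)
  then show ?case using 0(2) continuous_map_compose by (fastforce simp: o_def)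
next
  case (Suc k)
  have low: "Ck k U (\<lambda>x. h x i)" if "i < fst V" for i
    using Suc.prems(1) that Ck_antimono by blast
  have cont: "continuous_map (dom_topology U) euclideanreal (\<lambda>x. f (h x))"
    using Suc.IH[OF low Ck_antimono[OF Suc.prems(2)]] Ck_continuous by blast
  obtain g where g: "\<And>i. i < fst V \<Longrightarrow> Ck k V (g i)"
    "\<And>i x. i < fst V \<Longrightarrow> x \<in> carr V \<Longrightarrow> ((\<lambda>t. f (x(i := t))) has_real_derivative g i x) (at (x i))"
    using Suc.prems(2) by simp metis
  have "\<exists>f'. Ck k U f' \<and> (\<forall>x\<in>carr U. ((\<lambda>t. f (h (x(j := t)))) has_real_derivative f' x) (at (x j)))"
    if j: "j < fst U" for j
  proof -
    have "\<forall>i. i < fst V \<longrightarrow> (\<exists>d. Ck k U d \<and> (\<forall>x\<in>carr U. ((\<lambda>t. h (x(j := t)) i) has_real_derivative d x) (at (x j))))"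
      using Suc.prems(1) j by auto
    then obtain d where d: "\<And>i. i < fst V \<Longrightarrow> Ck k U (d i)"
      "\<And>i x. i < fst V \<Longrightarrow> x \<in> carr U \<Longrightarrow> ((\<lambda>t. h (x(j := t)) i) has_real_derivative d i x) (at (x j))"
      by metis
    have "Ck k U (\<lambda>x. \<Sum>i<fst V. g i (h x) * d i x)"
      by (rule Ck_sum, rule Ck_mult[OF Suc.IH[OF low g(1)] d(1)]) auto
    moreover have "((\<lambda>t. f (h (x(j := t)))) has_real_derivative (\<Sum>i<fst V. g i (h x) * d i x)) (at (x j))"
      if x: "x \<in> carr U" for x
    proof -
      \<comment> \<open>The trivial update exhibits the base point as the value at
        \<open>x j\<close> of the curve to which the chain rule is applied.\<close>
      have "((\<lambda>t. f (h (x(j := t)))) has_real_derivative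
          (\<Sum>i<fst V. g i (h (x(j := x j))) * d i x)) (at (x j))"
      proof (rule chain_rule_along_curve[OF V])
        show "\<forall>\<^sub>F t in at (x j). h (x(j := t)) \<in> carr V"
          using eventually_update_in_dom[OF U x j] h(1)
          by (auto simp: eventually_at_filter elim: eventually_mono)
        show "h (x(j := x j)) \<in> carr V" using h(1) x by simp
        show "continuous_map (dom_topology V) euclideanreal (g i)" if "i < fst V" for i
          using g(1)[OF that] by (rule Ck_continuous)
      qed (use g(2) d(2) x in blast)+
      then show ?thesis by simp
    qed
    ultimately show ?thesis by blast
  qed
  then show ?case using cont by simp
qed

section \<open>Smooth maps of cartesian spaces\<close>

lemma Cart_open: "U \<in> Cart \<Longrightarrow> open_dom U"
  by (simp add: Cart_def)

lemma cart_hom_compose: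
  assumes "open_dom U" "open_dom V" "f \<in> cart_hom U V" "g \<in> cart_hom V W"
  shows "compose (carr U) g f \<in> cart_hom U W"
proof -
  have "Ck k U (\<lambda>x. compose (carr U) g f x i)" if "i < fst W" for k i
  proof -
    have "Ck k U (\<lambda>x. g (f x) i)"
      by (rule Ck_compose[OF assms(1,2), where f = "\<lambda>x. g x i"]) (use assms(3,4) that in \<open>auto simp: cart_hom_def\<close>)
    then show ?thesis by (rule Ck_cong[OF assms(1)]) (simp add: compose_def)
  qed
  then show ?thesis using assms(3,4) by (auto simp: cart_hom_def compose_def)
qed

lemma cart_hom_inclusion:
  assumes "open_dom (n, V)" "V \<subseteq> U"
  shows "(\<lambda>x\<in>V. x) \<in> cart_hom (n, V) (n, U)"
proof -
  have "Ck k (n, V) (\<lambda>x. (\<lambda>x\<in>V. x) x i)" for k i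
    by (rule Ck_cong[OF assms(1) Ck_coordinate]) simp
  then show ?thesis using assms(2) by (auto simp: cart_hom_def)
qed

lemma cart_hom_ident: "open_dom U \<Longrightarrow> (\<lambda>x\<in>carr U. x) \<in> cart_hom U U"
  using cart_hom_inclusion[of "fst U" "snd U" "snd U"] by simp

lemma cart_hom_const:
  assumes "open_dom U" "v \<in> carr V"
  shows "(\<lambda>x\<in>carr U. v) \<in> cart_hom U V"
proof -
  have "Ck k U (\<lambda>x. (\<lambda>x\<in>carr U. v) x i)" for k i
    by (rule Ck_cong[OF assms(1) Ck_const]) simp
  then show ?thesis using assms(2) by (auto simp: cart_hom_def)
qed

section \<open>Diffeological spaces\<close>

abbreviation point_dom :: dom where "point_dom \<equiv> (0, topspace (Euclidean_space 0))"

lemma point_dom_Cart: "point_dom \<in> Cart"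
proof -
  have o: "open_dom point_dom" by (simp add: open_dom_def)
  have "diffeomorphic point_dom point_dom"
    unfolding diffeomorphic_def using cart_hom_ident[OF o] by (intro bexI) auto
  then show ?thesis using o by (auto simp: Cart_def)
qed

lemma point_dom_mem [simp]: "x \<in> topspace (Euclidean_space 0) \<longleftrightarrow> x = (\<lambda>_. 0)"
  by (auto simp: topspace_Euclidean_space)

lemma good_cover_single:
  assumes "U \<in> Cart"
  shows "good_cover U {carr U}"
  unfolding good_cover_def
proof (intro conjI allI impI ballI)
  fix \<F> assume "\<F> \<subseteq> {carr U} \<and> finite \<F> \<and> \<F> \<noteq> {} \<and> \<Inter>\<F> \<noteq> {}"
  then have "\<F> = {carr U}" by blast
  then show "(fst U, \<Inter>\<F>) \<in> Cart" using assms by simp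
qed (use assms in auto)

lemma good_coverD:
  assumes "good_cover U \<V>" "V \<in> \<V>"
  shows "(fst U, V) \<in> Cart" "V \<subseteq> carr U"
  using assms unfolding good_cover_def by blast+

text \<open>Isolates the one condition that the lemmas on composition and on groups of smooth maps
  ask of the domain. For the nebula and the levels of a nerve it can be read off from the definition
  of their plots.\<close>

abbreviation plots_ext :: "'x diffeology \<Rightarrow> bool" where
  "plots_ext X \<equiv> \<forall>U\<in>Cart. plots X U \<subseteq> carr U \<rightarrow>\<^sub>E points X"

lemma diffeological_space_ext: "diffeological_space X \<Longrightarrow> plots_ext X"
  by (simp add: diffeological_space_def)

lemma plot_in_points: "plots_ext X \<Longrightarrow> U \<in> Cart \<Longrightarrow> p \<in> plots X U \<Longrightarrow> u \<in> carr U \<Longrightarrow> p u \<in> points X"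
  by blast

lemma plot_compose:
  assumes "diffeological_space X" "U \<in> Cart" "V \<in> Cart" "p \<in> plots X U" "f \<in> cart_hom V U"
  shows "compose (carr V) p f \<in> plots X V"
  using assms by (simp add: diffeological_space_def)

lemma plot_local:
  assumes "diffeological_space X" "U \<in> Cart" "p \<in> carr U \<rightarrow>\<^sub>E points X" "good_cover U \<V>"
    and "\<And>V. V \<in> \<V> \<Longrightarrow> restrict p V \<in> plots X (fst U, V)"
  shows "p \<in> plots X U"
  using assms unfolding diffeological_space_def by blast

text \<open>A constant map factors through R^0, all of whose maps into \<open>X\<close> are
  plots.\<close>

lemma plot_const:
  assumes X: "diffeological_space X" and U: "U \<in> Cart" and x: "x \<in> points X"
  shows "(\<lambda>u\<in>carr U. x) \<in> plots X U"
proof -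
  have "(\<lambda>u\<in>carr point_dom. x) \<in> plots X point_dom"
    using X x by (auto simp: diffeological_space_def Let_def)
  moreover have "(\<lambda>u\<in>carr U. \<lambda>_. 0) \<in> cart_hom U point_dom"
    by (rule cart_hom_const[OF Cart_open[OF U]]) simp
  ultimately have "compose (carr U) (\<lambda>u\<in>carr point_dom. x) (\<lambda>u\<in>carr U. \<lambda>_. 0) \<in> plots X U"
    using plot_compose[OF X point_dom_Cart U] by blast
  moreover have "compose (carr U) (\<lambda>u\<in>carr point_dom. x) (\<lambda>u\<in>carr U. \<lambda>_. 0) = (\<lambda>u\<in>carr U. x)"
    by (rule ext) (simp add: compose_def)
  ultimately show ?thesis by simp
qed

section \<open>Smooth maps and their composition\<close>

lemma smooth_plot: "f \<in> smooth X Y \<Longrightarrow> U \<in> Cart \<Longrightarrow> p \<in> plots X U \<Longrightarrow> compose (carr U) f p \<in> plots Y U"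
  by (simp add: smooth_def)

lemma smooth_in: "f \<in> smooth X Y \<Longrightarrow> x \<in> points X \<Longrightarrow> f x \<in> points Y"
  by (auto simp: smooth_def)

lemma smooth_extensional: "f \<in> smooth X Y \<Longrightarrow> f \<in> extensional (points X)"
  by (auto simp: smooth_def PiE_def)

lemma smooth_eqI:
  "f \<in> smooth X Y \<Longrightarrow> g \<in> smooth X Z \<Longrightarrow> (\<And>x. x \<in> points X \<Longrightarrow> f x = g x) \<Longrightarrow> f = g"
  using smooth_extensional extensionalityI by metis

lemma smooth_compose:
  assumes "plots_ext X" "f \<in> smooth X Y" "g \<in> smooth Y Z"
  shows "compose (points X) g f \<in> smooth X Z"
proof -
  have "compose (carr U) (compose (points X) g f) p \<in> plots Z U" if "U \<in> Cart" "p \<in> plots X U" for U p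
  proof -
    have "compose (carr U) (compose (points X) g f) p = compose (carr U) g (compose (carr U) f p)"
      using plot_in_points[OF assms(1) that] by (auto simp: compose_def)
    then show ?thesis using smooth_plot assms that by metis
  qed
  then show ?thesis using assms(2,3) by (auto simp: smooth_def compose_def)
qed

text \<open>Yoneda: a smooth map on \<open>U\<close> is recovered by composing it with the identity
  plot.\<close>

lemma smooth_cart_diff:
  assumes X: "diffeological_space X" and U: "U \<in> Cart"
  shows "smooth (cart_diff U) X = plots X U"
proof (intro equalityI subsetI)
  fix p assume p: "p \<in> smooth (cart_diff U) X"
  have "compose (carr U) p (\<lambda>x\<in>carr U. x) \<in> plots X U"
    using smooth_plot[OF p U] cart_hom_ident[OF Cart_open[OF U]] by (simp add: cart_diff_def)
  moreover have "compose (carr U) p (\<lambda>x\<in>carr U. x) = p"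
    using smooth_extensional[OF p] by (auto simp: compose_def cart_diff_def extensional_def)
  ultimately show "p \<in> plots X U" by simp
next
  fix p assume "p \<in> plots X U"
  then show "p \<in> smooth (cart_diff U) X"
    using diffeological_space_ext[OF X] U plot_compose[OF X U] by (auto simp: smooth_def cart_diff_def)
qed

section \<open>Groups of smooth maps\<close>

lemma group_space_points [simp]: "points (group_space A) = carrier A"
  by (simp add: group_space_def)

lemma smooth_group_simps [simp]:
  "carrier (smooth_group X A) = smooth X (group_space A)"
  "f \<otimes>\<^bsub>smooth_group X A\<^esub> g = (\<lambda>x\<in>points X. f x \<otimes>\<^bsub>A\<^esub> g x)"
  "\<one>\<^bsub>smooth_group X A\<^esub> = (\<lambda>x\<in>points X. \<one>\<^bsub>A\<^esub>)"
  by (simp_all add: smooth_group_def)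

text \<open>Pointwise operations stay smooth because they are composites with the smooth structure
  maps of \<open>A\<close>: products through the pairing of two plots, inverses through inversion.
  The unit is smooth because constant maps are plots.\<close>

lemma smooth_group_comm_group:
  fixes A :: "'a diff_group"
  assumes A: "diffeological_abelian_group A" and X: "plots_ext X"
  shows "comm_group (smooth_group X A)"
proof -
  let ?A = "group_space A"
  interpret comm_group A using A by (simp add: diffeological_abelian_group_def)
  have S: "diffeological_space ?A" using A by (simp add: diffeological_abelian_group_def)
  show ?thesis
  proof (rule comm_groupI)
    fix f g assume "f \<in> carrier (smooth_group X A)" "g \<in> carrier (smooth_group X A)"
    then have fg: "f \<in> smooth X ?A" "g \<in> smooth X ?A" by simp_all
    have "compose (carr U) (\<lambda>x\<in>points X. f x \<otimes>\<^bsub>A\<^esub> g x) p \<in> plots ?A U"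
      if U: "U \<in> Cart" and p: "p \<in> plots X U" for U p
    proof -
      let ?q = "\<lambda>u\<in>carr U. (f (p u), g (p u))"
      have "?q \<in> plots (prod_diff ?A ?A) U"
        using smooth_plot[OF fg(1) U p] smooth_plot[OF fg(2) U p] smooth_in[OF fg(1)] smooth_in[OF fg(2)]
          plot_in_points[OF X U p]
        by (auto simp: prod_diff_def compose_def cong: restrict_cong)
      then have "compose (carr U) (\<lambda>(a, b) \<in> carrier A \<times> carrier A. a \<otimes>\<^bsub>A\<^esub> b) ?q \<in> plots ?A U"
        using A U smooth_plot unfolding diffeological_abelian_group_def by blast
      moreover have "compose (carr U) (\<lambda>(a, b) \<in> carrier A \<times> carrier A. a \<otimes>\<^bsub>A\<^esub> b) ?q
          = compose (carr U) (\<lambda>x\<in>points X. f x \<otimes>\<^bsub>A\<^esub> g x) p"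
        using smooth_in[OF fg(1)] smooth_in[OF fg(2)] plot_in_points[OF X U p] by (auto simp: compose_def)
      ultimately show ?thesis by simp
    qed
    then show "f \<otimes>\<^bsub>smooth_group X A\<^esub> g \<in> carrier (smooth_group X A)"
      using fg smooth_in by (fastforce simp: smooth_def)
  next
    have "compose (carr U) (\<lambda>x\<in>points X. \<one>\<^bsub>A\<^esub>) p \<in> plots ?A U"
      if U: "U \<in> Cart" and p: "p \<in> plots X U" for U p
    proof -
      have "compose (carr U) (\<lambda>x\<in>points X. \<one>\<^bsub>A\<^esub>) p = (\<lambda>u\<in>carr U. \<one>\<^bsub>A\<^esub>)"
        using plot_in_points[OF X U p] by (auto simp: compose_def)
      then show ?thesis using plot_const[OF S U] by simp
    qed
    then show "\<one>\<^bsub>smooth_group X A\<^esub> \<in> carrier (smooth_group X A)"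
      by (auto simp: smooth_def)
  next
    fix f assume "f \<in> carrier (smooth_group X A)"
    then have f: "f \<in> smooth X ?A" by simp
    have i: "(\<lambda>a\<in>carrier A. inv\<^bsub>A\<^esub> a) \<in> smooth ?A ?A"
      using A by (simp add: diffeological_abelian_group_def)
    have "compose (points X) (\<lambda>a\<in>carrier A. inv\<^bsub>A\<^esub> a) f \<otimes>\<^bsub>smooth_group X A\<^esub> f = \<one>\<^bsub>smooth_group X A\<^esub>"
      using smooth_in[OF f] by (auto simp: compose_def)
    then show "\<exists>g\<in>carrier (smooth_group X A). g \<otimes>\<^bsub>smooth_group X A\<^esub> f = \<one>\<^bsub>smooth_group X A\<^esub>"
      using smooth_compose[OF X f i] unfolding smooth_group_simps by blast
  next
    fix f assume "f \<in> carrier (smooth_group X A)"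
    then have f: "f \<in> smooth X ?A" by simp
    show "\<one>\<^bsub>smooth_group X A\<^esub> \<otimes>\<^bsub>smooth_group X A\<^esub> f = f"
      using smooth_extensional[OF f] smooth_in[OF f] by (auto simp: extensional_def)
  next
    fix f g h
    assume "f \<in> carrier (smooth_group X A)" "g \<in> carrier (smooth_group X A)" "h \<in> carrier (smooth_group X A)"
    then show "f \<otimes>\<^bsub>smooth_group X A\<^esub> g \<otimes>\<^bsub>smooth_group X A\<^esub> h = f \<otimes>\<^bsub>smooth_group X A\<^esub> (g \<otimes>\<^bsub>smooth_group X A\<^esub> h)"
      using smooth_in[of _ X ?A] by (auto simp: m_assoc)
  next
    fix f g assume "f \<in> carrier (smooth_group X A)" "g \<in> carrier (smooth_group X A)"
    then show "f \<otimes>\<^bsub>smooth_group X A\<^esub> g = g \<otimes>\<^bsub>smooth_group X A\<^esub> f"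
      using smooth_in[of _ X ?A] by (auto simp: m_comm)
  qed
qed

section \<open>The nebula\<close>

lemma nebula_points: "points (nebula X) = {(P, u). P \<in> all_plots X \<and> u \<in> carr (fst P)}"
  by (auto simp: nebula_def coprod_diff_def cart_diff_def Let_def)

lemma nebula_plots:
  "plots (nebula X) U = {q \<in> carr U \<rightarrow>\<^sub>E points (nebula X). \<exists>\<V>. good_cover U \<V> \<and>
     (\<forall>V\<in>\<V>. \<exists>P\<in>all_plots X. \<exists>r\<in>cart_hom (fst U, V) (fst P). \<forall>v\<in>V. q v = (P, r v))}"
  by (simp add: nebula_def coprod_diff_def cart_diff_def Let_def)

lemma plots_ext_nebula: "plots_ext (nebula X)"
  by (auto simp: nebula_plots)

lemma all_plots_Cart: "P \<in> all_plots X \<Longrightarrow> fst P \<in> Cart"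
  and all_plots_plot: "P \<in> all_plots X \<Longrightarrow> snd P \<in> plots X (fst P)"
  by (auto simp: all_plots_def)

lemma nebula_proj_in:
  assumes "diffeological_space X" "b \<in> points (nebula X)"
  shows "nebula_proj b \<in> points X"
proof -
  obtain P u where "b = (P, u)" "P \<in> all_plots X" "u \<in> carr (fst P)"
    using assms(2) by (auto simp: nebula_points)
  then show ?thesis
    using plot_in_points[OF diffeological_space_ext[OF assms(1)] all_plots_Cart all_plots_plot]
    by (simp add: nebula_proj_def)
qed

text \<open>On each member of a suitable good cover a plot of the nebula lies in one component
  \<open>P\<close>, where the projection turns it into \<open>snd P\<close> after a smooth map. The
  covering axiom of \<open>X\<close> glues these plots.\<close>

lemma nebula_proj_smooth:
  assumes X: "diffeological_space X"
  shows "restrict nebula_proj (points (nebula X)) \<in> smooth (nebula X) X"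
proof -
  let ?\<pi> = "restrict nebula_proj (points (nebula X))"
  have "compose (carr U) ?\<pi> q \<in> plots X U" if U: "U \<in> Cart" and q: "q \<in> plots (nebula X) U" for U q
  proof -
    obtain \<V> where \<V>: "good_cover U \<V>"
      "\<And>V. V \<in> \<V> \<Longrightarrow> \<exists>P\<in>all_plots X. \<exists>r\<in>cart_hom (fst U, V) (fst P). \<forall>v\<in>V. q v = (P, r v)"
      using q by (auto simp: nebula_plots)
    have qp: "q u \<in> points (nebula X)" if "u \<in> carr U" for u
      using plot_in_points[OF plots_ext_nebula U q that] .
    show ?thesis
    proof (rule plot_local[OF X U _ \<V>(1)])
      show "compose (carr U) ?\<pi> q \<in> carr U \<rightarrow>\<^sub>E points X"
        using qp nebula_proj_in[OF X] by (auto simp: compose_def)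
      fix V assume V: "V \<in> \<V>"
      obtain P r where P: "P \<in> all_plots X" "r \<in> cart_hom (fst U, V) (fst P)" "\<forall>v\<in>V. q v = (P, r v)"
        using \<V>(2)[OF V] by blast
      have "restrict (compose (carr U) ?\<pi> q) V = compose V (snd P) r"
      proof
        fix v
        show "restrict (compose (carr U) ?\<pi> q) V v = compose V (snd P) r v"
        proof (cases "v \<in> V")
          case True
          then have "v \<in> carr U" "q v = (P, r v)" using good_coverD(2)[OF \<V>(1) V] P(3) by auto
          then show ?thesis using True qp[of v] by (simp add: compose_def nebula_proj_def)
        qed (simp add: compose_def)
      qed
      then show "restrict (compose (carr U) ?\<pi> q) V \<in> plots X (fst U, V)"
        using plot_compose[OF X all_plots_Cart[OF P(1)] good_coverD(1)[OF \<V>(1) V] all_plots_plot[OF P(1)] P(2)]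
        by simp
    qed
  qed
  then show ?thesis using nebula_proj_in[OF X] by (auto simp: smooth_def)
qed

lemma nebula_inclusion_plot:
  assumes "P \<in> all_plots X"
  shows "(\<lambda>u\<in>carr (fst P). (P, u)) \<in> plots (nebula X) (fst P)"
proof -
  have "(\<lambda>u\<in>carr (fst P). u) \<in> cart_hom (fst (fst P), carr (fst P)) (fst P)"
    using cart_hom_ident[OF Cart_open[OF all_plots_Cart[OF assms]]] by simp
  then have "\<exists>\<V>. good_cover (fst P) \<V> \<and> (\<forall>V\<in>\<V>. \<exists>Q\<in>all_plots X. \<exists>r\<in>cart_hom (fst (fst P), V) (fst Q).
       \<forall>v\<in>V. (\<lambda>u\<in>carr (fst P). (P, u)) v = (Q, r v))"
    using assms good_cover_single[OF all_plots_Cart[OF assms]]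
    by (intro exI[of _ "{carr (fst P)}"]) (auto intro!: bexI[of _ P] bexI[of _ "\<lambda>u\<in>carr (fst P). u"])
  then show ?thesis using assms by (simp add: nebula_plots nebula_points)
qed

definition base_plot :: "'x \<Rightarrow> 'x plot" where
  "base_plot x = (point_dom, \<lambda>u\<in>carr point_dom. x)"

text \<open>The zero sequence is the only element of R^0. As a section of the projection this is not
  smooth in general, since distinct points of \<open>X\<close> land in distinct components.\<close>

definition base_point :: "'x \<Rightarrow> 'x plot \<times> vec" where
  "base_point x = (base_plot x, \<lambda>_. 0)"

lemma base_plot_in: "diffeological_space X \<Longrightarrow> x \<in> points X \<Longrightarrow> base_plot x \<in> all_plots X"
  using plot_const[OF _ point_dom_Cart] point_dom_Cart by (simp add: base_plot_def all_plots_def)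

lemma base_point_in: "diffeological_space X \<Longrightarrow> x \<in> points X \<Longrightarrow> base_point x \<in> points (nebula X)"
  using base_plot_in by (fastforce simp: base_point_def nebula_points base_plot_def)

lemma nebula_proj_base_point [simp]: "nebula_proj (base_point x) = x"
  by (simp add: nebula_proj_def base_point_def base_plot_def)

text \<open>Composing \<open>f\<close> with \<open>base_point\<close> proves nothing, as the latter
  need not be smooth. Invariance replaces the value at \<open>base_point (p u)\<close> by the value
  at \<open>u\<close> in the component of \<open>p\<close> itself, and the inclusion of that
  component is a plot.\<close>

lemma smooth_descend:
  assumes X: "diffeological_space X" and f: "f \<in> smooth (nebula X) Y"
    and inv: "\<And>b. b \<in> points (nebula X) \<Longrightarrow> f (base_point (nebula_proj b)) = f b"
  shows "(\<lambda>x\<in>points X. f (base_point x)) \<in> smooth X Y"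
proof -
  have "compose (carr U) (\<lambda>x\<in>points X. f (base_point x)) p \<in> plots Y U"
    if U: "U \<in> Cart" and p: "p \<in> plots X U" for U p
  proof -
    have P: "(U, p) \<in> all_plots X" using U p by (simp add: all_plots_def)
    have "compose (carr U) f (\<lambda>u\<in>carr U. ((U, p), u)) \<in> plots Y U"
      using smooth_plot[OF f U] nebula_inclusion_plot[OF P] by simp
    moreover have "f (base_point (p u)) = f ((U, p), u)" if "u \<in> carr U" for u
      using inv[of "((U, p), u)"] P that by (simp add: nebula_points nebula_proj_def)
    then have "compose (carr U) f (\<lambda>u\<in>carr U. ((U, p), u)) = compose (carr U) (\<lambda>x\<in>points X. f (base_point x)) p"
      using plot_in_points[OF diffeological_space_ext[OF X] U p] by (auto simp: compose_def)
    ultimately show ?thesis by simp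
  qed
  then show ?thesis using smooth_in[OF f base_point_in[OF X]] by (auto simp: smooth_def)
qed

section \<open>Cohomology in degree zero\<close>

text \<open>The exponents are \<open>(-1)^0\<close> and \<open>(-1)^1\<close>, so in multiplicative
  notation the differential is the first coface divided by the second.\<close>

lemma differential_0:
  assumes "comm_group (C (Suc 0))" "\<delta> 0 0 x \<in> carrier (C (Suc 0))" "\<delta> 0 (Suc 0) x \<in> carrier (C (Suc 0))"
  shows "differential C \<delta> 0 x = \<one>\<^bsub>C (Suc 0)\<^esub> \<longleftrightarrow> \<delta> 0 0 x = \<delta> 0 (Suc 0) x"
proof -
  interpret comm_group "C (Suc 0)" by fact
  have *: "{0..0 + 1} = {0, Suc 0}" by auto
  have "differential C \<delta> 0 x = \<delta> 0 0 x \<otimes>\<^bsub>C (Suc 0)\<^esub> inv\<^bsub>C (Suc 0)\<^esub> (\<delta> 0 (Suc 0) x)"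
    using assms(2,3) int_pow_neg_int[of _ 1] unfolding differential_def * by simp
  also have "\<dots> = \<one>\<^bsub>C (Suc 0)\<^esub> \<longleftrightarrow> \<delta> 0 0 x = \<delta> 0 (Suc 0) x"
    using assms(2,3) inv_solve_right' by auto
  finally show ?thesis .
qed

text \<open>In degree zero the kernel is divided by the trivial subgroup. The cosets are singletons,
  so the isomorphism is \<open>h\<close> with its values put in braces.\<close>

lemma iso_cohomology_0:
  assumes "group (C 0)"
    and h: "h \<in> hom G (C 0)"
    and b: "bij_betw h (carrier G) (kernel (C 0) (C (Suc 0)) (differential C \<delta> 0))"
  shows "G \<cong> cohomology C \<delta> 0"
proof -
  interpret group "C 0" by fact
  let ?K = "kernel (C 0) (C (Suc 0)) (differential C \<delta> 0)"
  have sub: "?K \<subseteq> carrier (C 0)" by (auto simp: kernel_def)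
  have r: "{\<one>\<^bsub>C 0\<^esub>} #>\<^bsub>C 0\<^esub> k = {k}" if "k \<in> ?K" for k
    using sub that by (auto simp: r_coset_def)
  have c: "carrier (cohomology C \<delta> 0) = (\<lambda>k. {k}) ` ?K"
    by (auto simp: cohomology_def FactGroup_def RCOSETS_def r)
  have m: "{k} \<otimes>\<^bsub>cohomology C \<delta> 0\<^esub> {l} = {k \<otimes>\<^bsub>C 0\<^esub> l}" for k l
    by (simp add: cohomology_def FactGroup_def set_mult_def)
  have "(\<lambda>x. {h x}) \<in> iso G (cohomology C \<delta> 0)"
  proof (rule isoI)
    show "(\<lambda>x. {h x}) \<in> hom G (cohomology C \<delta> 0)"
      using b by (auto intro!: homI simp: c m hom_mult[OF h] dest: bij_betw_apply)
    show "bij_betw (\<lambda>x. {h x}) (carrier G) (carrier (cohomology C \<delta> 0))"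
      using b unfolding c by (auto simp: bij_betw_def inj_on_def)
  qed
  then show ?thesis by (auto simp: is_iso_def)
qed

section \<open>Levels zero and one of a nerve\<close>

lemma nerve_points_0: "points (level (nerve \<C>) 0) = points (obj \<C>) \<times> {[]}"
  by (auto simp: nerve_def sub_diff_def prod_diff_def power_diff_def Let_def)

lemma nerve_points_1:
  "points (level (nerve \<C>) (Suc 0)) =
     {(b, [m]) | b m. b \<in> points (obj \<C>) \<and> m \<in> points (mor \<C>) \<and> source \<C> m = b}"
  by (auto simp: nerve_def sub_diff_def prod_diff_def power_diff_def Let_def length_Suc_conv)

lemma plots_ext_nerve: "plots_ext (level (nerve \<C>) n)"
proof -
  have "p \<in> carr U \<rightarrow>\<^sub>E points (level (nerve \<C>) n)" if p: "p \<in> plots (level (nerve \<C>) n) U" for U p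
  proof -
    let ?D = "prod_diff (obj \<C>) (power_diff (mor \<C>) n)"
    have "p \<in> carr U \<rightarrow>\<^sub>E points ?D" "p ` carr U \<subseteq> {(x, fs). chain (source \<C>) (target \<C>) x fs}"
      using p by (auto simp: nerve_def sub_diff_def prod_diff_def)
    moreover have "points (level (nerve \<C>) n) = points ?D \<inter> {(x, fs). chain (source \<C>) (target \<C>) x fs}"
      by (simp add: nerve_def sub_diff_def)
    ultimately show ?thesis by (auto simp: PiE_def)
  qed
  then show ?thesis by blast
qed

lemma nerve_plots_0:
  "p \<in> plots (level (nerve \<C>) 0) U \<longleftrightarrow>
     p \<in> carr U \<rightarrow>\<^sub>E points (level (nerve \<C>) 0) \<and> (\<lambda>u\<in>carr U. fst (p u)) \<in> plots (obj \<C>) U"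
  unfolding nerve_points_0
  by (auto simp: nerve_def sub_diff_def prod_diff_def power_diff_def Let_def PiE_iff extensional_def)

lemma nerve_plots_1:
  assumes "p \<in> plots (level (nerve \<C>) (Suc 0)) U"
  shows "(\<lambda>u\<in>carr U. fst (p u)) \<in> plots (obj \<C>) U"
    and "(\<lambda>u\<in>carr U. hd (snd (p u))) \<in> plots (mor \<C>) U"
proof -
  show "(\<lambda>u\<in>carr U. fst (p u)) \<in> plots (obj \<C>) U"
    using assms by (simp add: nerve_def sub_diff_def prod_diff_def)
  have "(\<lambda>u\<in>carr U. (\<lambda>u\<in>carr U. snd (p u)) u ! 0) \<in> plots (mor \<C>) U"
    using assms by (simp add: nerve_def sub_diff_def prod_diff_def power_diff_def Let_def)
  moreover have "(\<lambda>u\<in>carr U. (\<lambda>u\<in>carr U. snd (p u)) u ! 0) = (\<lambda>u\<in>carr U. hd (snd (p u)))"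
  proof (rule restrict_ext)
    fix u assume u: "u \<in> carr U"
    have "snd (p u) \<noteq> []"
      using assms u by (fastforce simp: nerve_def sub_diff_def prod_diff_def power_diff_def Let_def PiE_iff)
    then show "(\<lambda>u\<in>carr U. snd (p u)) u ! 0 = hd (snd (p u))" using u by (simp add: hd_conv_nth)
  qed
  ultimately show "(\<lambda>u\<in>carr U. hd (snd (p u))) \<in> plots (mor \<C>) U" by simp
qed

lemma nerve_face_1:
  "face (nerve \<C>) (Suc 0) 0 (b, [m]) = (target \<C> m, [])"
  "face (nerve \<C>) (Suc 0) (Suc 0) (b, [m]) = (b, [])"
  by (simp_all add: nerve_def chain_face_def)

text \<open>On a chain \<open>(b, [m])\<close> face 0 is the target of \<open>m\<close>, whose
  smoothness is assumed, while face 1 is the recorded initial object \<open>b\<close>, a projection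
  of the product.\<close>

lemma nerve_face_smooth:
  assumes t: "restrict (target \<C>) (points (mor \<C>)) \<in> smooth (mor \<C>) (obj \<C>)"
    and ext: "plots_ext (mor \<C>)" and i: "i \<le> 1"
  shows "restrict (face (nerve \<C>) (Suc 0) i) (points (level (nerve \<C>) (Suc 0)))
           \<in> smooth (level (nerve \<C>) (Suc 0)) (level (nerve \<C>) 0)"
proof -
  let ?L = "level (nerve \<C>)"
  let ?f = "restrict (face (nerve \<C>) (Suc 0) i) (points (?L (Suc 0)))"
  have fp: "?f z \<in> points (?L 0)" if "z \<in> points (?L (Suc 0))" for z
  proof (cases "i = 0")
    case True
    then show ?thesis using that smooth_in[OF t] by (auto simp: nerve_points_0 nerve_points_1 nerve_face_1)
  next
    case False
    then have "i = Suc 0" using i by simp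
    then show ?thesis using that by (auto simp: nerve_points_0 nerve_points_1 nerve_face_1)
  qed
  have "compose (carr U) ?f p \<in> plots (?L 0) U" if U: "U \<in> Cart" and p: "p \<in> plots (?L (Suc 0)) U" for U p
  proof -
    have pp: "p u \<in> points (?L (Suc 0))" if "u \<in> carr U" for u
      using plot_in_points[OF plots_ext_nerve U p that] .
    \<comment> \<open>A chain at level one carries exactly one arrow; naming it as a function of
      \<open>u\<close> lets both faces be computed.\<close>
    then obtain m where m: "\<And>u. u \<in> carr U \<Longrightarrow> p u = (fst (p u), [m u]) \<and> m u \<in> points (mor \<C>)"
      unfolding nerve_points_1 by atomize_elim (rule choice, fastforce)
    have "(\<lambda>u\<in>carr U. fst (compose (carr U) ?f p u)) \<in> plots (obj \<C>) U"
    proof (cases "i = 0")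
      case True
      have "compose (carr U) (restrict (target \<C>) (points (mor \<C>))) (\<lambda>u\<in>carr U. hd (snd (p u))) \<in> plots (obj \<C>) U"
        by (rule smooth_plot[OF t U nerve_plots_1(2)[OF p]])
      moreover have "fst (?f (p u)) = target \<C> (m u)" "hd (snd (p u)) = m u" if "u \<in> carr U" for u
        using m[OF that] pp[OF that] True by (metis fst_conv nerve_face_1(1) restrict_apply')
          (metis m that list.sel(1) snd_conv)
      ultimately show ?thesis
        using m by (simp add: compose_def cong: restrict_cong)
    next
      case False
      then have "i = Suc 0" using i by simp
      then have "fst (?f (p u)) = fst (p u)" if "u \<in> carr U" for u
        using m[OF that] pp[OF that] by (metis fst_conv nerve_face_1(2) restrict_apply')
      then show ?thesis using nerve_plots_1(1)[OF p] by (simp add: compose_def cong: restrict_cong)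
    qed
    then show ?thesis using fp pp by (auto simp: nerve_plots_0 compose_def)
  qed
  then show ?thesis using fp by (simp add: smooth_def)
qed

text \<open>A degree-zero cocycle is a map on objects taking equal values at the source and target of each
  morphism, which by the last two hypotheses means that it is constant on the fibres of the projection.\<close>

lemma nerve_cohomology_0:
  fixes X :: "'x diffeology" and A :: "'a diff_group" and \<C> :: "('x plot \<times> vec, 'm) diff_category"
  assumes X: "diffeological_space X" and A: "diffeological_abelian_group A"
    and ob: "obj \<C> = nebula X"
    and ext: "plots_ext (mor \<C>)"
    and t: "restrict (target \<C>) (points (mor \<C>)) \<in> smooth (mor \<C>) (nebula X)"
    and fib: "\<And>m. m \<in> points (mor \<C>) \<Longrightarrow> nebula_proj (source \<C> m) = nebula_proj (target \<C> m)"
    and base: "\<And>b. b \<in> points (nebula X) \<Longrightarrow>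
      \<exists>m\<in>points (mor \<C>). source \<C> m = base_point (nebula_proj b) \<and> target \<C> m = b"
  shows "smooth_group X A \<cong> simp_diff_cohomology (nerve \<C>) A 0"
proof -
  let ?L = "level (nerve \<C>)" and ?A = "group_space A"
  let ?C = "\<lambda>n. smooth_group (?L n) A"
  let ?\<delta> = "\<lambda>n i f. compose (points (?L (Suc n))) f (face (nerve \<C>) (Suc n) i)"
  let ?\<Phi> = "\<lambda>g. \<lambda>z\<in>points (?L 0). g (nebula_proj (fst z))"
  have grp: "comm_group (?C n)" for n by (rule smooth_group_comm_group[OF A plots_ext_nerve])
  \<comment> \<open>The two faces of \<open>(b, [m])\<close> are the ends of \<open>m\<close>, so
    the two cofaces of \<open>f\<close> agree just when \<open>f\<close> takes equal values at the
    ends of every arrow.\<close>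
  have cocycle: "f \<in> kernel (?C 0) (?C (Suc 0)) (differential ?C ?\<delta> 0) \<longleftrightarrow>
      f \<in> smooth (?L 0) ?A \<and> (\<forall>m\<in>points (mor \<C>). source \<C> m \<in> points (nebula X) \<longrightarrow>
        f (target \<C> m, []) = f (source \<C> m, []))" for f
  proof (cases "f \<in> smooth (?L 0) ?A")
    case True
    have "?\<delta> 0 i f \<in> carrier (?C (Suc 0))" if "i \<le> 1" for i
    proof -
      \<comment> \<open>Elements of \<open>smooth\<close> are extensional, so the face is restricted
        to the level before it is composed.\<close>
      have "compose (points (?L (Suc 0))) f (restrict (face (nerve \<C>) (Suc 0) i) (points (?L (Suc 0))))
          \<in> smooth (?L (Suc 0)) ?A"
        using smooth_compose[OF plots_ext_nerve nerve_face_smooth True] t ob ext that by metis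
      then show ?thesis by (simp add: compose_def cong: restrict_cong)
    qed
    then have "differential ?C ?\<delta> 0 f = \<one>\<^bsub>?C (Suc 0)\<^esub> \<longleftrightarrow> ?\<delta> 0 0 f = ?\<delta> 0 (Suc 0) f"
      by (intro differential_0[OF grp]) simp_all
    also have "\<dots> \<longleftrightarrow> (\<forall>z\<in>points (?L (Suc 0)). f (face (nerve \<C>) (Suc 0) 0 z) = f (face (nerve \<C>) (Suc 0) (Suc 0) z))"
      by (auto simp: compose_def fun_eq_iff restrict_def)
    also have "\<dots> \<longleftrightarrow> (\<forall>m\<in>points (mor \<C>). source \<C> m \<in> points (nebula X) \<longrightarrow>
        f (target \<C> m, []) = f (source \<C> m, []))"
    proof -
      have "(\<forall>z\<in>points (?L (Suc 0)). P z) \<longleftrightarrow>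
          (\<forall>m\<in>points (mor \<C>). source \<C> m \<in> points (nebula X) \<longrightarrow> P (source \<C> m, [m]))" for P
        unfolding nerve_points_1 ob by blast
      then show ?thesis by (simp add: nerve_face_1)
    qed
    finally show ?thesis using True by (simp add: kernel_def)
  qed (simp add: kernel_def)
  \<comment> \<open>Level zero is the nebula with an empty list attached; this map and
    \<open>j\<close> below pass between the two.\<close>
  have fst_smooth: "restrict fst (points (?L 0)) \<in> smooth (?L 0) (nebula X)"
  proof -
    have "compose (carr U) (restrict fst (points (?L 0))) p \<in> plots (nebula X) U"
      if U: "U \<in> Cart" and p: "p \<in> plots (?L 0) U" for U p
      using p plot_in_points[OF plots_ext_nerve U p]
      by (simp add: nerve_plots_0 compose_def ob cong: restrict_cong)
    then show ?thesis by (auto simp: smooth_def nerve_points_0 ob)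
  qed
  have \<Phi>: "?\<Phi> g \<in> kernel (?C 0) (?C (Suc 0)) (differential ?C ?\<delta> 0)" if g: "g \<in> smooth X ?A" for g
  proof -
    have "compose (points (?L 0)) g (compose (points (?L 0)) (restrict nebula_proj (points (nebula X)))
        (restrict fst (points (?L 0)))) \<in> smooth (?L 0) ?A"
      by (rule smooth_compose[OF plots_ext_nerve
            smooth_compose[OF plots_ext_nerve fst_smooth nebula_proj_smooth[OF X]] g])
    moreover have "compose (points (?L 0)) g (compose (points (?L 0)) (restrict nebula_proj (points (nebula X)))
        (restrict fst (points (?L 0)))) = ?\<Phi> g"
      by (auto simp: compose_def nerve_points_0 ob)
    moreover have "target \<C> m \<in> points (nebula X)" if "m \<in> points (mor \<C>)" for m
      using smooth_in[OF t that] that by simp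
    ultimately show ?thesis unfolding cocycle using fib by (auto simp: nerve_points_0 ob)
  qed
  have bp: "(base_point x, []) \<in> points (?L 0)" if "x \<in> points X" for x
    using base_point_in[OF X that] by (simp add: nerve_points_0 ob)
  show ?thesis
    unfolding simp_diff_cohomology_def
  proof (rule iso_cohomology_0)
    show "group (?C 0)" using grp by (rule comm_group.axioms)
    show "?\<Phi> \<in> hom (smooth_group X A) (?C 0)"
    proof (rule homI)
      fix g assume "g \<in> carrier (smooth_group X A)"
      then show "?\<Phi> g \<in> carrier (?C 0)" using \<Phi>[of g] by (simp add: kernel_def)
    next
      fix g h
      show "?\<Phi> (g \<otimes>\<^bsub>smooth_group X A\<^esub> h) = ?\<Phi> g \<otimes>\<^bsub>?C 0\<^esub> ?\<Phi> h"
        using nebula_proj_in[OF X] by (auto simp: nerve_points_0 ob)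
    qed
    show "bij_betw ?\<Phi> (carrier (smooth_group X A)) (kernel (?C 0) (?C (Suc 0)) (differential ?C ?\<delta> 0))"
    proof (rule bij_betw_imageI)
      show "inj_on ?\<Phi> (carrier (smooth_group X A))"
      proof (rule inj_onI)
        fix g h
        assume gh: "g \<in> carrier (smooth_group X A)" "h \<in> carrier (smooth_group X A)" "?\<Phi> g = ?\<Phi> h"
        \<comment> \<open>Every point of \<open>X\<close> is the projection of its base point, where
          the value of \<open>g\<close> can be read off.\<close>
        have "g x = h x" if "x \<in> points X" for x
          using fun_cong[OF gh(3), of "(base_point x, [])"] bp[OF that] by simp
        then show "g = h" using gh smooth_eqI[of g X ?A h ?A] by simp
      qed
      have "\<exists>g\<in>smooth X ?A. ?\<Phi> g = f"
        if f: "f \<in> kernel (?C 0) (?C (Suc 0)) (differential ?C ?\<delta> 0)" for f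
      proof -
        define k where "k = (\<lambda>b\<in>points (nebula X). f (b, []))"
        have fs: "f \<in> smooth (?L 0) ?A" using f cocycle by blast
        have j: "(\<lambda>b\<in>points (nebula X). (b, [])) \<in> smooth (nebula X) (?L 0)"
        proof -
          have "compose (carr U) (\<lambda>b\<in>points (nebula X). (b, [])) q \<in> plots (?L 0) U"
            if U: "U \<in> Cart" and q: "q \<in> plots (nebula X) U" for U q
          proof -
            let ?p = "compose (carr U) (\<lambda>b\<in>points (nebula X). (b, [] :: 'm list)) q"
            have q1: "q \<in> carr U \<rightarrow>\<^sub>E points (nebula X)" using U q plots_ext_nebula by blast
            have "(\<lambda>u\<in>carr U. fst (?p u)) = q"
            proof (rule extensionalityI)
              show "q \<in> extensional (carr U)" using q1 by (simp add: PiE_def)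
            qed (use q1 in \<open>auto simp: compose_def PiE_iff\<close>)
            moreover have "?p \<in> carr U \<rightarrow>\<^sub>E points (?L 0)"
              using q1 by (auto simp: compose_def nerve_points_0 ob)
            ultimately show ?thesis using q by (simp add: nerve_plots_0 ob)
          qed
          then show ?thesis by (auto simp: smooth_def nerve_points_0 ob)
        qed
        have "compose (points (nebula X)) f (\<lambda>b\<in>points (nebula X). (b, [])) \<in> smooth (nebula X) ?A"
          by (rule smooth_compose[OF plots_ext_nebula j fs])
        then have k: "k \<in> smooth (nebula X) ?A" by (simp add: k_def compose_def cong: restrict_cong)
        \<comment> \<open>The arrow supplied by \<open>base\<close> has these two points as its
          ends, and a cocycle does not distinguish them.\<close>
        have inv: "k (base_point (nebula_proj b)) = k b" if b: "b \<in> points (nebula X)" for b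
        proof -
          obtain m where "m \<in> points (mor \<C>)" "source \<C> m = base_point (nebula_proj b)" "target \<C> m = b"
            using base[OF b] by blast
          moreover have "base_point (nebula_proj b) \<in> points (nebula X)"
            using base_point_in[OF X nebula_proj_in[OF X b]] .
          ultimately show ?thesis using f b unfolding cocycle k_def by auto
        qed
        have "?\<Phi> (\<lambda>x\<in>points X. k (base_point x)) = f"
        proof (rule extensionalityI)
          show "f \<in> extensional (points (?L 0))" by (rule smooth_extensional[OF fs])
          show "?\<Phi> (\<lambda>x\<in>points X. k (base_point x)) z = f z" if z: "z \<in> points (?L 0)" for z
          proof -
            obtain b where "z = (b, [])" "b \<in> points (nebula X)" using z by (auto simp: nerve_points_0 ob)
            then show ?thesis using z inv[of b] nebula_proj_in[OF X, of b]
                base_point_in[OF X, of "nebula_proj b"] by (simp add: k_def)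
          qed
        qed simp
        then show ?thesis using smooth_descend[OF X k inv] by blast
      qed
      then show "?\<Phi> ` carrier (smooth_group X A) = kernel (?C 0) (?C (Suc 0)) (differential ?C ?\<delta> 0)"
        using \<Phi> by auto
    qed
  qed
qed

section \<open>The two diffeological categories\<close>

lemma plots_ext_sub_diff:
  assumes "plots_ext X"
  shows "plots_ext (sub_diff X S)"
proof (intro ballI subsetI)
  fix U p assume "U \<in> Cart" "p \<in> plots (sub_diff X S) U"
  then have "p \<in> carr U \<rightarrow>\<^sub>E points X" "p ` carr U \<subseteq> S" using assms by (auto simp: sub_diff_def)
  then show "p \<in> carr U \<rightarrow>\<^sub>E points (sub_diff X S)" by (auto simp: sub_diff_def PiE_iff)
qed

lemma plots_ext_prod_diff: "plots_ext (prod_diff X Y)"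
  unfolding prod_diff_def by simp

lemma H_KWW_iso:
  fixes X :: "'x diffeology" and A :: "'a diff_group"
  assumes X: "diffeological_space X" and A: "diffeological_abelian_group A"
  shows "smooth_group X A \<cong> H_KWW 0 X A"
  unfolding H_KWW_def
proof (rule nerve_cohomology_0[OF X A])
  let ?\<C> = "cech_groupoid X"
  show "obj ?\<C> = nebula X" by (simp add: cech_groupoid_def)
  show ext: "plots_ext (mor ?\<C>)"
  proof -
    have "mor ?\<C> = sub_diff (prod_diff (nebula X) (nebula X)) {(b, c). nebula_proj b = nebula_proj c}"
      by (simp add: cech_groupoid_def)
    then show ?thesis using plots_ext_sub_diff[OF plots_ext_prod_diff] by metis
  qed
  show "restrict (target ?\<C>) (points (mor ?\<C>)) \<in> smooth (mor ?\<C>) (nebula X)"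
  proof -
    have "compose (carr U) (restrict (target ?\<C>) (points (mor ?\<C>))) p \<in> plots (nebula X) U"
      if U: "U \<in> Cart" and p: "p \<in> plots (mor ?\<C>) U" for U p
    proof -
      have "(\<lambda>u\<in>carr U. snd (p u)) \<in> plots (nebula X) U"
        using p by (simp add: cech_groupoid_def sub_diff_def prod_diff_def)
      moreover have "compose (carr U) (restrict (target ?\<C>) (points (mor ?\<C>))) p = (\<lambda>u\<in>carr U. snd (p u))"
        using plot_in_points[OF ext U p] by (auto simp: compose_def cech_groupoid_def)
      ultimately show ?thesis by simp
    qed
    then show ?thesis by (auto simp: smooth_def cech_groupoid_def sub_diff_def prod_diff_def)
  qed
  show "nebula_proj (source ?\<C> m) = nebula_proj (target ?\<C> m)" if "m \<in> points (mor ?\<C>)" for m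
    using that by (auto simp: cech_groupoid_def sub_diff_def)
  show "\<exists>m\<in>points (mor ?\<C>). source ?\<C> m = base_point (nebula_proj b) \<and> target ?\<C> m = b"
    if b: "b \<in> points (nebula X)" for b
    using b base_point_in[OF X nebula_proj_in[OF X b]]
    by (intro bexI[of _ "(base_point (nebula_proj b), b)"]) (auto simp: cech_groupoid_def sub_diff_def prod_diff_def)
qed

text \<open>The projection is preserved only if the collapsed component lies in the fibre of
  \<open>b\<close>, which is why \<open>P\<close> will be the one-point plot
  \<open>base_plot\<close>.\<close>

definition move_component :: "'x diffeology \<Rightarrow> 'x plot \<Rightarrow> 'x plot \<times> vec \<Rightarrow> 'x plot \<times> vec \<Rightarrow> 'x plot \<times> vec" where
  "move_component X P b = (\<lambda>c\<in>points (nebula X). if fst c = P then b else c)"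

text \<open>Locally a plot of the nebula stays in one component, and there the map is either
  constant or the inclusion. The jump between components is invisible to plots.\<close>

lemma move_component_smooth:
  assumes b: "b \<in> points (nebula X)"
  shows "move_component X P b \<in> smooth (nebula X) (nebula X)"
proof -
  obtain Q w where Q: "b = (Q, w)" "Q \<in> all_plots X" "w \<in> carr (fst Q)"
    using b by (auto simp: nebula_points)
  have "compose (carr U) (move_component X P b) q \<in> plots (nebula X) U"
    if U: "U \<in> Cart" and q: "q \<in> plots (nebula X) U" for U q
  proof -
    have qp: "q u \<in> points (nebula X)" if "u \<in> carr U" for u
      using plot_in_points[OF plots_ext_nebula U q that] .
    obtain \<V> where \<V>: "good_cover U \<V>"
      "\<And>V. V \<in> \<V> \<Longrightarrow> \<exists>P\<in>all_plots X. \<exists>r\<in>cart_hom (fst U, V) (fst P). \<forall>v\<in>V. q v = (P, r v)"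
      using q by (auto simp: nebula_plots)
    have "\<exists>P'\<in>all_plots X. \<exists>r\<in>cart_hom (fst U, V) (fst P').
        \<forall>v\<in>V. compose (carr U) (move_component X P b) q v = (P', r v)" if V: "V \<in> \<V>" for V
    proof -
      obtain P' r where P': "P' \<in> all_plots X" "r \<in> cart_hom (fst U, V) (fst P')" "\<forall>v\<in>V. q v = (P', r v)"
        using \<V>(2)[OF V] by blast
      have eq: "compose (carr U) (move_component X P b) q v = (if P' = P then b else (P', r v))" if "v \<in> V" for v
        using that good_coverD(2)[OF \<V>(1) V] qp[of v] P'(3) by (auto simp: compose_def move_component_def)
      show ?thesis
      proof (cases "P' = P")
        case True
        have "(\<lambda>x\<in>V. w) \<in> cart_hom (fst U, V) (fst Q)"
          using cart_hom_const[OF Cart_open[OF good_coverD(1)[OF \<V>(1) V]] Q(3)] by simp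
        then show ?thesis using eq True Q by (intro bexI[of _ Q] bexI[of _ "\<lambda>x\<in>V. w"]) auto
      next
        case False
        then show ?thesis using eq P' by auto
      qed
    qed
    then have "\<exists>\<V>. good_cover U \<V> \<and> (\<forall>V\<in>\<V>. \<exists>P'\<in>all_plots X. \<exists>r\<in>cart_hom (fst U, V) (fst P').
        \<forall>v\<in>V. compose (carr U) (move_component X P b) q v = (P', r v))"
      using \<V>(1) by blast
    moreover have "compose (carr U) (move_component X P b) q \<in> carr U \<rightarrow>\<^sub>E points (nebula X)"
      using qp b by (auto simp: compose_def move_component_def)
    ultimately show ?thesis by (simp add: nebula_plots)
  qed
  then show ?thesis using b by (auto simp: smooth_def move_component_def)
qed

text \<open>The only point of the collapsed component lies over \<open>nebula_proj b\<close>, as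
  \<open>b\<close> does, so the projection is respected.\<close>

lemma move_component_in:
  assumes X: "diffeological_space X" and b: "b \<in> points (nebula X)"
  shows "move_component X (base_plot (nebula_proj b)) b \<in> points (nebula_monoid X)"
proof -
  have "nebula_proj (move_component X (base_plot (nebula_proj b)) b c) = nebula_proj c"
    if c: "c \<in> points (nebula X)" for c
    using c by (auto simp: move_component_def nebula_points nebula_proj_def base_plot_def)
  then show ?thesis
    using move_component_smooth[OF b] by (simp add: nebula_monoid_def sub_diff_def functional_diff_def)
qed

text \<open>A plot of maps is smooth in both variables jointly and may be evaluated along the graph
  \<open>(u, q u)\<close>. This yields smoothness of the target map of the action category.\<close>

lemma functional_diff_eval:
  assumes U: "U \<in> Cart" and p: "p \<in> plots (functional_diff X Y) U" and q: "q \<in> plots X U"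
    and X: "plots_ext X"
  shows "(\<lambda>u\<in>carr U. p u (q u)) \<in> plots Y U"
proof -
  let ?e = "\<lambda>(u, x) \<in> carr U \<times> points X. p u x"
  have e: "?e \<in> smooth (prod_diff (cart_diff U) X) Y" using p by (simp add: functional_diff_def)
  have qp: "q \<in> carr U \<rightarrow>\<^sub>E points X" using X U q by blast
  then have "(\<lambda>u\<in>carr U. q u) = q" by (simp add: PiE_restrict)
  then have "(\<lambda>u\<in>carr U. (u, q u)) \<in> plots (prod_diff (cart_diff U) X) U"
    using cart_hom_ident[OF Cart_open[OF U]] q qp by (auto simp: prod_diff_def cart_diff_def cong: restrict_cong)
  then have "compose (carr U) ?e (\<lambda>u\<in>carr U. (u, q u)) \<in> plots Y U"
    by (rule smooth_plot[OF e U])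
  moreover have "compose (carr U) ?e (\<lambda>u\<in>carr U. (u, q u)) = (\<lambda>u\<in>carr U. p u (q u))"
  proof
    show "compose (carr U) ?e (\<lambda>u\<in>carr U. (u, q u)) u = (\<lambda>u\<in>carr U. p u (q u)) u" for u
      using qp by (cases "u \<in> carr U") (auto simp: compose_def PiE_iff)
  qed
  ultimately show ?thesis by simp
qed

lemma H_PIZ_iso:
  fixes X :: "'x diffeology" and A :: "'a diff_group"
  assumes X: "diffeological_space X" and A: "diffeological_abelian_group A"
  shows "smooth_group X A \<cong> H_PIZ 0 X A"
  unfolding H_PIZ_def
proof (rule nerve_cohomology_0[OF X A])
  let ?\<C> = "action_category X"
  show "obj ?\<C> = nebula X" by (simp add: action_category_def)
  show ext: "plots_ext (mor ?\<C>)"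
  proof -
    have "mor ?\<C> = prod_diff (nebula X) (nebula_monoid X)" by (simp add: action_category_def)
    then show ?thesis using plots_ext_prod_diff by metis
  qed
  have mem: "m b \<in> points (nebula X)" if "m \<in> points (nebula_monoid X)" "b \<in> points (nebula X)" for m b
    using that smooth_in by (auto simp: nebula_monoid_def sub_diff_def functional_diff_def)
  show "restrict (target ?\<C>) (points (mor ?\<C>)) \<in> smooth (mor ?\<C>) (nebula X)"
  proof -
    have "compose (carr U) (restrict (target ?\<C>) (points (mor ?\<C>))) p \<in> plots (nebula X) U"
      if U: "U \<in> Cart" and p: "p \<in> plots (mor ?\<C>) U" for U p
    proof -
      have "(\<lambda>u\<in>carr U. fst (p u)) \<in> plots (nebula X) U"
        "(\<lambda>u\<in>carr U. snd (p u)) \<in> plots (functional_diff (nebula X) (nebula X)) U"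
        using p by (simp_all add: action_category_def prod_diff_def nebula_monoid_def sub_diff_def)
      from functional_diff_eval[OF U this(2) this(1) plots_ext_nebula]
      have "(\<lambda>u\<in>carr U. snd (p u) (fst (p u))) \<in> plots (nebula X) U" by (simp cong: restrict_cong)
      moreover have "compose (carr U) (restrict (target ?\<C>) (points (mor ?\<C>))) p
          = (\<lambda>u\<in>carr U. snd (p u) (fst (p u)))"
        using plot_in_points[OF ext U p] by (auto simp: compose_def action_category_def split_beta)
      ultimately show ?thesis by simp
    qed
    then show ?thesis using mem by (auto simp: smooth_def action_category_def prod_diff_def)
  qed
  show "nebula_proj (source ?\<C> m) = nebula_proj (target ?\<C> m)" if "m \<in> points (mor ?\<C>)" for m
    using that by (auto simp: action_category_def prod_diff_def nebula_monoid_def sub_diff_def)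
  show "\<exists>m\<in>points (mor ?\<C>). source ?\<C> m = base_point (nebula_proj b) \<and> target ?\<C> m = b"
    if b: "b \<in> points (nebula X)" for b
  proof -
    have "base_point (nebula_proj b) \<in> points (nebula X)"
      using base_point_in[OF X nebula_proj_in[OF X b]] .
    then show ?thesis
      using move_component_in[OF X b]
      by (intro bexI[of _ "(base_point (nebula_proj b), move_component X (base_plot (nebula_proj b)) b)"])
        (auto simp: action_category_def prod_diff_def move_component_def base_point_def)
  qed
qed

section \<open>The infinity cohomology in degree zero\<close>

lemma chain_append:
  "chain src tgt x (as @ bs) \<longleftrightarrow>
     chain src tgt x as \<and> chain src tgt (if as = [] then x else tgt (last as)) bs"
  by (induction as arbitrary: x) auto

lemma plot_maps_compose:
  assumes "a \<in> plot_maps X" "b \<in> plot_maps X" "plot_tgt a = plot_src b"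
  shows "plot_comp a b \<in> plot_maps X"
    and "plot_src (plot_comp a b) = plot_src a" "plot_tgt (plot_comp a b) = plot_tgt b"
proof -
  obtain P f Q g R where ab: "a = (P, f, Q)" "b = (Q, g, R)"
    using assms(3) by (cases a, cases b) auto
  have f: "f \<in> cart_hom (fst P) (fst Q)" "compose (carr (fst P)) (snd Q) f = snd P" "P \<in> all_plots X" "Q \<in> all_plots X"
    and g: "g \<in> cart_hom (fst Q) (fst R)" "compose (carr (fst Q)) (snd R) g = snd Q" "R \<in> all_plots X"
    using assms unfolding ab plot_maps_def by auto
  have "compose (carr (fst P)) g f \<in> cart_hom (fst P) (fst R)"
    by (rule cart_hom_compose[OF _ _ f(1) g(1)]) (use f all_plots_Cart Cart_open in blast)+
  moreover have "compose (carr (fst P)) (snd R) (compose (carr (fst P)) g f) = snd P"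
  proof -
    have "f u \<in> carr (fst Q)" if "u \<in> carr (fst P)" for u using f(1) that by (auto simp: cart_hom_def)
    then have "compose (carr (fst P)) (snd R) (compose (carr (fst P)) g f)
        = compose (carr (fst P)) (compose (carr (fst Q)) (snd R) g) f"
      by (auto simp: compose_def)
    then show ?thesis using f g by simp
  qed
  ultimately show "plot_comp a b \<in> plot_maps X"
    using f(3) g(3) by (simp add: ab plot_comp_def plot_maps_def)
qed (use assms(3) in \<open>simp_all add: plot_comp_def split_beta\<close>)

lemma all_plots_extensional:
  assumes X: "diffeological_space X" and P: "P \<in> all_plots X"
  shows "snd P \<in> carr (fst P) \<rightarrow>\<^sub>E points X"
  using diffeological_space_ext[OF X] all_plots_Cart[OF P] all_plots_plot[OF P] by blast

text \<open>The identity is restricted to the domain; as plots are extensional, composing with it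
  gives back the same function, also off the domain.\<close>

lemma plot_ident_in:
  assumes X: "diffeological_space X" and P: "P \<in> all_plots X"
  shows "plot_ident P \<in> plot_maps X"
proof -
  have "compose (carr (fst P)) (snd P) (\<lambda>x\<in>carr (fst P). x) = snd P"
    using all_plots_extensional[OF X P] by (intro ext) (auto simp: compose_def PiE_iff extensional_def)
  then show ?thesis
    using P cart_hom_ident[OF Cart_open[OF all_plots_Cart[OF P]]] by (simp add: plot_ident_def plot_maps_def)
qed

lemma QX_sec_iff:
  "((P, as), h) \<in> sec (QX X) k U \<longleftrightarrow> P \<in> all_plots X \<and> length as = k \<and> set as \<subseteq> plot_maps X \<and>
     chain plot_src plot_tgt P as \<and> h \<in> cart_hom U (fst P)"
  by (simp add: QX_def)

lemma QX_restr: "restr (QX X) k V U f (c, h) = (c, compose (carr V) h f)"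
  by (simp add: QX_def)

lemma QX_sface:
  "sface (QX X) k i U (c, h) = (chain_face plot_tgt plot_comp i c,
     if i = 0 then compose (carr U) (plot_fun (hd (snd c))) h else h)"
  by (simp add: QX_def)

lemma QX_sdegen: "sdegen (QX X) k i U (c, h) = (chain_degen plot_tgt plot_ident i c, h)"
  by (simp add: QX_def)

lemma plot_maps_hd:
  assumes "((P, as), h) \<in> sec (QX X) (Suc k) U"
  obtains f Q bs where "as = (P, f, Q) # bs" "f \<in> cart_hom (fst P) (fst Q)" "Q \<in> all_plots X"
    "compose (carr (fst P)) (snd Q) f = snd P"
proof -
  obtain a bs where a: "as = a # bs" using assms by (cases as) (auto simp: QX_sec_iff)
  obtain P' f Q where "a = (P', f, Q)" by (cases a)
  then show ?thesis using that assms a unfolding QX_sec_iff by (auto simp: plot_maps_def)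
qed

lemma QX_restr_in:
  assumes "z \<in> sec (QX X) k U" "f \<in> cart_hom V U" "U \<in> Cart" "V \<in> Cart"
  shows "restr (QX X) k V U f z \<in> sec (QX X) k V"
proof -
  obtain P as h where z: "z = ((P, as), h)" by (metis surj_pair)
  show ?thesis
    using assms cart_hom_compose[OF Cart_open Cart_open, of V U f h]
    unfolding z QX_restr QX_sec_iff by blast
qed

lemma QX_sface_in:
  assumes "((P, as), h) \<in> sec (QX X) (Suc k) U" "i \<le> Suc k" "U \<in> Cart"
  shows "sface (QX X) (Suc k) i U ((P, as), h) \<in> sec (QX X) k U"
proof -
  note s = assms(1)[unfolded QX_sec_iff]
  consider "i = 0" | "i = Suc k" | "0 < i" "i < Suc k" using assms(2) by linarith
  then show ?thesis
  proof cases
    case 1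
    obtain f Q bs where f: "as = (P, f, Q) # bs" "f \<in> cart_hom (fst P) (fst Q)" "Q \<in> all_plots X"
      using plot_maps_hd[OF assms(1)] by metis
    \<comment> \<open>Dropping the first arrow changes the initial plot from \<open>P\<close> to
      \<open>Q\<close>, so the section moves along \<open>f\<close>.\<close>
    have "compose (carr U) f h \<in> cart_hom U (fst Q)"
      by (rule cart_hom_compose[OF _ _ _ f(2)]) (use s assms(3) Cart_open all_plots_Cart in blast)+
    then show ?thesis using s f 1 by (simp add: QX_sface QX_sec_iff chain_face_def)
  next
    case 2
    have "as \<noteq> []" using s by auto
    then have "chain plot_src plot_tgt P (butlast as)"
      using s chain_append[of plot_src plot_tgt P "butlast as" "[last as]"] by simp
    then show ?thesis
      using s 2 by (auto simp: QX_sface QX_sec_iff chain_face_def dest: in_set_butlastD)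
  next
    case 3
    \<comment> \<open>Face \<open>i\<close> composes two neighbouring arrows, stored in the list at
      positions \<open>i - 1\<close> and \<open>i\<close>.\<close>
    define as1 a b as2 where d: "as1 = take (i - 1) as" "a = as ! (i - 1)" "b = as ! i" "as2 = drop (i + 1) as"
    have "as = take (i - 1) as @ as ! (i - 1) # drop i as"
      using id_take_nth_drop[of "i - 1" as] s 3 by simp
    also have "drop i as = as ! i # drop (i + 1) as"
      using Cons_nth_drop_Suc[of i as] s 3 by simp
    finally have as: "as = as1 @ [a, b] @ as2" unfolding d by simp
    have len: "length as = Suc k" and ab: "a \<in> plot_maps X" "b \<in> plot_maps X" "plot_tgt a = plot_src b"
      using s unfolding as by (auto simp: chain_append)
    have "chain plot_src plot_tgt P (as1 @ [plot_comp a b] @ as2)"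
      using s plot_maps_compose(2,3)[OF ab] unfolding as by (simp only: chain_append chain.simps) (simp split: if_splits)
    moreover have "chain_face plot_tgt plot_comp i (P, as) = (P, as1 @ [plot_comp a b] @ as2)"
      using 3 len by (simp add: chain_face_def d)
    ultimately show ?thesis
      using s 3 plot_maps_compose(1)[OF ab] unfolding QX_sface by (simp add: QX_sec_iff as)
  qed
qed

lemma QX_sdegen_in:
  assumes X: "diffeological_space X" and "((P, as), h) \<in> sec (QX X) k U" "i \<le> k"
  shows "sdegen (QX X) k i U ((P, as), h) \<in> sec (QX X) (Suc k) U"
proof -
  note s = assms(2)[unfolded QX_sec_iff]
  \<comment> \<open>The object of the chain at which the identity is inserted; \<open>Qe\<close>
    brings it into the form used by \<open>chain_append\<close>.\<close>
  define Q where "Q = (if i = 0 then P else plot_tgt (as ! (i - 1)))"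
  have Q: "Q \<in> all_plots X"
  proof (cases "i = 0")
    case False
    then have "as ! (i - 1) \<in> plot_maps X" using s assms(3) nth_mem[of "i - 1" as] by force
    then show ?thesis using False by (auto simp: Q_def plot_maps_def)
  qed (use s in \<open>simp add: Q_def\<close>)
  have Qe: "Q = (if take i as = [] then P else plot_tgt (last (take i as)))"
    using s assms(3) by (auto simp: Q_def last_conv_nth)
  have "chain plot_src plot_tgt P (take i as @ drop i as)" using s by simp
  then have c: "chain plot_src plot_tgt P (take i as)" "chain plot_src plot_tgt Q (drop i as)"
    unfolding chain_append Qe by blast+
  have "chain plot_src plot_tgt P (take i as @ [plot_ident Q] @ drop i as)"
    using c Qe unfolding chain_append by (auto simp: plot_ident_def)
  moreover have "set (take i as) \<subseteq> plot_maps X" "set (drop i as) \<subseteq> plot_maps X"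
    using s by (meson order_trans set_take_subset set_drop_subset)+
  ultimately show ?thesis
    using s plot_ident_in[OF X Q] assms(3)
    by (simp add: QX_sdegen chain_degen_def QX_sec_iff Q_def[symmetric])
qed

section \<open>Mapping spaces into a discrete presheaf\<close>

lemma times_simplex_simps:
  "sec (times_simplex Y n) k U = sec Y k U \<times> std_simplex n k"
  "restr (times_simplex Y n) k V U f (y, s) = (restr Y k V U f y, s)"
  "sface (times_simplex Y n) k i U (y, s) = (sface Y k i U y, take i s @ drop (Suc i) s)"
  "sdegen (times_simplex Y n) k i U (y, s) = (sdegen Y k i U y, take (Suc i) s @ drop i s)"
  by (simp_all add: times_simplex_def)

lemma std_simplex_0: "s \<in> std_simplex 0 k \<longleftrightarrow> s = replicate (Suc k) 0"
  using replicate_eqI[of s "Suc k" 0] by (auto simp: std_simplex_def simp del: replicate_Suc)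

text \<open>The simplicial operators of the target are identities, so compatibility with faces and
  degeneracies turns into invariance of values.\<close>

lemma map_space_group_iff:
  "\<phi> \<in> map_space Y (group_spre A) n \<longleftrightarrow>
     (\<forall>k. \<phi> k \<in> (\<Pi>\<^sub>E U\<in>Cart. (sec Y k U \<times> std_simplex n k) \<rightarrow>\<^sub>E smooth (cart_diff U) (group_space A))) \<and>
     (\<forall>k. \<forall>U\<in>Cart. \<forall>V\<in>Cart. \<forall>f\<in>cart_hom V U. \<forall>y\<in>sec Y k U. \<forall>s\<in>std_simplex n k.
        \<phi> k V (restr Y k V U f y, s) = compose (carr V) (\<phi> k U (y, s)) f) \<and>
     (\<forall>k. \<forall>U\<in>Cart. \<forall>i\<le>Suc k. \<forall>y\<in>sec Y (Suc k) U. \<forall>s\<in>std_simplex n (Suc k).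
        \<phi> k U (sface Y (Suc k) i U y, take i s @ drop (Suc i) s) = \<phi> (Suc k) U (y, s)) \<and>
     (\<forall>k. \<forall>U\<in>Cart. \<forall>i\<le>k. \<forall>y\<in>sec Y k U. \<forall>s\<in>std_simplex n k.
        \<phi> (Suc k) U (sdegen Y k i U y, take (Suc i) s @ drop i s) = \<phi> k U (y, s))"
  unfolding map_space_def spre_hom_def by (simp add: times_simplex_simps group_spre_def)

lemma map_space_maps:
  "\<phi> \<in> map_space Y (group_spre A) n \<Longrightarrow>
   \<phi> k \<in> (\<Pi>\<^sub>E U\<in>Cart. (sec Y k U \<times> std_simplex n k) \<rightarrow>\<^sub>E smooth (cart_diff U) (group_space A))"
  by (drule map_space_group_iff[THEN iffD1, THEN conjunct1]) (rule spec)

lemma map_space_in: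
  "\<lbrakk>\<phi> \<in> map_space Y (group_spre A) n; U \<in> Cart; y \<in> sec Y k U; s \<in> std_simplex n k\<rbrakk>
   \<Longrightarrow> \<phi> k U (y, s) \<in> smooth (cart_diff U) (group_space A)"
  by (rule PiE_mem[OF PiE_mem[OF map_space_maps]]) auto

lemma map_space_restr:
  "\<lbrakk>\<phi> \<in> map_space Y (group_spre A) n; U \<in> Cart; V \<in> Cart; f \<in> cart_hom V U; y \<in> sec Y k U; s \<in> std_simplex n k\<rbrakk>
   \<Longrightarrow> \<phi> k V (restr Y k V U f y, s) = compose (carr V) (\<phi> k U (y, s)) f"
  by (drule map_space_group_iff[THEN iffD1, THEN conjunct2, THEN conjunct1]) blast

lemma map_space_face:
  "\<lbrakk>\<phi> \<in> map_space Y (group_spre A) n; U \<in> Cart; i \<le> Suc k; y \<in> sec Y (Suc k) U; s \<in> std_simplex n (Suc k)\<rbrakk>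
   \<Longrightarrow> \<phi> k U (sface Y (Suc k) i U y, take i s @ drop (Suc i) s) = \<phi> (Suc k) U (y, s)"
  by (drule map_space_group_iff[THEN iffD1, THEN conjunct2, THEN conjunct2, THEN conjunct1]) blast

lemma map_space_eqI:
  assumes "\<phi> \<in> map_space Y (group_spre A) n" "\<psi> \<in> map_space Y (group_spre A) n"
    and "\<And>k U y s. U \<in> Cart \<Longrightarrow> y \<in> sec Y k U \<Longrightarrow> s \<in> std_simplex n k \<Longrightarrow> \<phi> k U (y, s) = \<psi> k U (y, s)"
  shows "\<phi> = \<psi>"
proof (intro ext)
  fix k U z u
  note m = map_space_maps[OF assms(1), of k] map_space_maps[OF assms(2), of k]
  show "\<phi> k U z u = \<psi> k U z u"
  proof (cases "U \<in> Cart")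
    case True
    note m' = m[THEN PiE_mem, OF True]
    show ?thesis
    proof (cases "z \<in> sec Y k U \<times> std_simplex n k")
      case z: True
      then show ?thesis using assms(3)[OF True] by auto
    qed (simp add: m'[THEN PiE_arb])
  qed (simp add: m[THEN PiE_arb])
qed

text \<open>The target is discrete, so iterating the last face determines a map by its values on vertices.\<close>

lemma map_space_vertex:
  assumes "\<phi> \<in> map_space (QX X) (group_spre A) n" "U \<in> Cart"
    and "((P, as), h) \<in> sec (QX X) k U" "s \<in> std_simplex n k"
  shows "\<phi> k U (((P, as), h), s) = \<phi> 0 U (((P, []), h), [hd s])"
  using assms(3,4)
proof (induction k arbitrary: as s)
  case 0
  then show ?case by (auto simp: QX_sec_iff std_simplex_def length_Suc_conv)
next
  case (Suc k)
  have len: "length as = Suc k" "length s = Suc (Suc k)"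
    using Suc.prems by (auto simp: QX_sec_iff std_simplex_def)
  \<comment> \<open>The last face, unlike face 0, keeps both \<open>P\<close> and \<open>h\<close>;
    it also keeps the first entry of \<open>s\<close>.\<close>
  have f: "sface (QX X) (Suc k) (Suc k) U ((P, as), h) = ((P, butlast as), h)"
    using len by (simp add: QX_sface chain_face_def)
  have b: "take (Suc k) s @ drop (Suc (Suc k)) s = butlast s"
    using len by (simp add: butlast_conv_take)
  have bs: "butlast s \<in> std_simplex n k"
    using Suc.prems(2) by (auto simp: std_simplex_def sorted_butlast dest: in_set_butlastD)
  have "\<phi> (Suc k) U (((P, as), h), s) = \<phi> k U (((P, butlast as), h), butlast s)"
    using map_space_face[OF assms(1,2) _ Suc.prems, of "Suc k"] f b by simp
  also have "\<dots> = \<phi> 0 U (((P, []), h), [hd (butlast s)])"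
    using Suc.IH[OF _ bs] QX_sface_in[OF Suc.prems(1) _ assms(2), of "Suc k"] f by simp
  also have "hd (butlast s) = hd s"
    using len by (cases s) auto
  finally show ?case .
qed

text \<open>The degenerate simplex on an identity arrow is paired with the nondegenerate edge
  \<open>[0, 1]\<close>. Both faces have the same first component, their second components are
  \<open>[1]\<close> and \<open>[0]\<close>, and neither face changes the value.\<close>

lemma map_space_edge:
  assumes X: "diffeological_space X" and e: "e \<in> map_space (QX X) (group_spre A) 1"
    and U: "U \<in> Cart" and y: "((P, []), h) \<in> sec (QX X) 0 U"
  shows "e 0 U (((P, []), h), [0]) = e 0 U (((P, []), h), [1])"
proof -
  let ?z = "((P, [plot_ident P]), h)"
  have h: "P \<in> all_plots X" "h \<in> cart_hom U (fst P)" using y by (auto simp: QX_sec_iff)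
  have z: "?z \<in> sec (QX X) (Suc 0) U"
    using h plot_ident_in[OF X] by (simp add: QX_sec_iff) (simp add: plot_ident_def)
  have s: "[0, 1] \<in> std_simplex 1 (Suc 0)" by (simp add: std_simplex_def)
  have "compose (carr U) (\<lambda>x\<in>carr (fst P). x) h = h"
    using h(2) by (intro ext) (auto simp: compose_def cart_hom_def PiE_iff extensional_def)
  then have "sface (QX X) (Suc 0) 0 U ?z = ((P, []), h)"
    by (simp add: QX_sface chain_face_def plot_ident_def)
  moreover have "sface (QX X) (Suc 0) (Suc 0) U ?z = ((P, []), h)"
    by (simp add: QX_sface chain_face_def)
  ultimately show ?thesis
    using map_space_face[OF e U _ z s, of 0] map_space_face[OF e U _ z s, of "Suc 0"] by simp
qed

text \<open>By \<open>map_space_vertex\<close> and \<open>map_space_edge\<close> the two ends of an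
  edge coincide, so the generated equivalence relation is equality.\<close>

lemma pi0_rel_QX:
  assumes X: "diffeological_space X"
  shows "pi0_rel (QX X) (group_spre A) = Id_on (map_space (QX X) (group_spre A) 0)"
proof -
  have eq: "map_space_op (QX X) 0 (coface 1) e = map_space_op (QX X) 0 (coface 0) e"
    if e: "e \<in> map_space (QX X) (group_spre A) 1" for e
  proof -
    have *: "e k U (y, map (coface 1) s) = e k U (y, map (coface 0) s)"
      if U: "U \<in> Cart" and y: "y \<in> sec (QX X) k U" and s: "s \<in> std_simplex 0 k" for k U y s
    proof -
      obtain P as h where z: "y = ((P, as), h)" by (metis surj_pair)
      have s': "s = replicate (Suc k) 0" using s std_simplex_0 by blast
      have "map (coface j) s \<in> std_simplex 1 k" for j
        by (simp add: std_simplex_def s' coface_def set_replicate_conv_if)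
      \<comment> \<open>Only the first entry matters: \<open>coface 1\<close> sends 0 to 0 and
        \<open>coface 0\<close> sends 0 to 1.\<close>
      then have "e k U (y, map (coface j) s) = e 0 U (((P, []), h), [coface j 0])" for j
        using map_space_vertex[OF e U y[unfolded z]] z s' by simp
      moreover have "((P, []), h) \<in> sec (QX X) 0 U" using y by (simp add: z QX_sec_iff)
      ultimately show ?thesis
        using map_space_edge[OF X e U] by (simp add: coface_def)
    qed
    show ?thesis
      unfolding map_space_op_def
      by (intro ext restrict_ext) (auto simp: times_simplex_simps *[unfolded One_nat_def] intro!: restrict_ext)
  qed
  let ?E = "{(map_space_op (QX X) 0 (coface 1) e, map_space_op (QX X) 0 (coface 0) e) | e.
                 e \<in> map_space (QX X) (group_spre A) 1}"
  have sub: "?E \<union> ?E\<inverse> \<subseteq> Id" using eq by fastforce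
  have "x = y" if "(x, y) \<in> (?E \<union> ?E\<inverse>)\<^sup>*" for x y
    using that
  proof induction
    case (step y z)
    then show ?case using sub by blast
  qed simp
  then have "(?E \<union> ?E\<inverse>)\<^sup>* = Id" by auto
  then show ?thesis unfolding pi0_rel_def Let_def by auto
qed

text \<open>The augmentation from \<open>QX\<close> to \<open>X\<close>, followed by
  \<open>g\<close>. In \<open>z = (((P, as), h), s)\<close> the nested projections pick the
  underlying function of \<open>P\<close> and the section \<open>h\<close>.\<close>

definition evaluate_plots ::
  "'x diffeology \<Rightarrow> ('x \<Rightarrow> 'a) \<Rightarrow>
   nat \<Rightarrow> dom \<Rightarrow> (('x plot \<times> 'x plot_map list) \<times> (vec \<Rightarrow> vec)) \<times> nat list \<Rightarrow> vec \<Rightarrow> 'a" where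
  "evaluate_plots X g k = (\<lambda>U\<in>Cart. \<lambda>z\<in>sec (times_simplex (QX X) 0) k U.
     compose (carr U) g (compose (carr U) (snd (fst (fst (fst z)))) (snd (fst z))))"

lemma evaluate_plots_apply:
  "\<lbrakk>U \<in> Cart; ((P, as), h) \<in> sec (QX X) k U; s \<in> std_simplex 0 k\<rbrakk>
   \<Longrightarrow> evaluate_plots X g k U (((P, as), h), s) = compose (carr U) g (compose (carr U) (snd P) h)"
  by (simp add: evaluate_plots_def times_simplex_simps)

text \<open>Face 0 replaces \<open>P\<close> by \<open>Q\<close> and \<open>h\<close> by
  \<open>f\<close> after \<open>h\<close>; the value is unchanged because \<open>f\<close> is a map
  of plots. All other simplicial operators keep \<open>P\<close> and \<open>h\<close>.\<close>

lemma evaluate_plots_in: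
  assumes X: "diffeological_space X" and A: "diffeological_abelian_group A"
    and g: "g \<in> smooth X (group_space A)"
  shows "evaluate_plots X g \<in> map_space (QX X) (group_spre A) 0"
proof -
  let ?e = "evaluate_plots X g"
  have SA: "diffeological_space (group_space A)" using A by (simp add: diffeological_abelian_group_def)
  have val: "compose (carr U) g (compose (carr U) (snd P) h) \<in> smooth (cart_diff U) (group_space A)"
    if U: "U \<in> Cart" and P: "P \<in> all_plots X" and h: "h \<in> cart_hom U (fst P)" for U P h
    unfolding smooth_cart_diff[OF SA U]
    by (rule smooth_plot[OF g U plot_compose[OF X all_plots_Cart[OF P] U all_plots_plot[OF P] h]])
  have "?e k \<in> (\<Pi>\<^sub>E U\<in>Cart. (sec (QX X) k U \<times> std_simplex 0 k) \<rightarrow>\<^sub>E smooth (cart_diff U) (group_space A))" for k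
    unfolding evaluate_plots_def times_simplex_simps restrict_PiE_iff
  proof (intro ballI)
    fix U z assume U: "U \<in> Cart" and z: "z \<in> sec (QX X) k U \<times> std_simplex 0 k"
    obtain P as h s where "z = (((P, as), h), s)" by (metis surj_pair)
    then show "compose (carr U) g (compose (carr U) (snd (fst (fst (fst z)))) (snd (fst z)))
        \<in> smooth (cart_diff U) (group_space A)"
      using val[OF U, of P h] z by (simp add: QX_sec_iff)
  qed
  moreover have "?e k V (restr (QX X) k V U f y, s) = compose (carr V) (?e k U (y, s)) f"
    if U: "U \<in> Cart" and V: "V \<in> Cart" and f: "f \<in> cart_hom V U"
      and y: "y \<in> sec (QX X) k U" and s: "s \<in> std_simplex 0 k" for k U V f y s
  proof -
    obtain P as h where z: "y = ((P, as), h)" by (metis surj_pair)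
    have r: "((P, as), compose (carr V) h f) \<in> sec (QX X) k V"
      using QX_restr_in[OF y f U V] by (simp add: z QX_restr)
    have "f v \<in> carr U" if "v \<in> carr V" for v using f that by (auto simp: cart_hom_def)
    then show ?thesis
      unfolding z QX_restr evaluate_plots_apply[OF V r s] evaluate_plots_apply[OF U y[unfolded z] s]
      by (auto simp: compose_def)
  qed
  moreover have "?e k U (sface (QX X) (Suc k) i U y, take i s @ drop (Suc i) s) = ?e (Suc k) U (y, s)"
    if U: "U \<in> Cart" and i: "i \<le> Suc k" and y: "y \<in> sec (QX X) (Suc k) U" and s: "s \<in> std_simplex 0 (Suc k)"
    for k U i y s
  proof -
    obtain P as h where z: "y = ((P, as), h)" by (metis surj_pair)
    have s': "take i s @ drop (Suc i) s \<in> std_simplex 0 k"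
      using s i by (simp add: std_simplex_0 flip: replicate_Suc replicate_add)
    have sf: "sface (QX X) (Suc k) i U ((P, as), h) \<in> sec (QX X) k U"
      using QX_sface_in[OF y[unfolded z] i U] .
    show ?thesis
    proof (cases "i = 0")
      case True
      obtain f Q bs where f: "as = (P, f, Q) # bs" "compose (carr (fst P)) (snd Q) f = snd P"
        using plot_maps_hd[OF y[unfolded z]] by metis
      have face: "sface (QX X) (Suc k) i U ((P, as), h) = ((Q, bs), compose (carr U) f h)"
        using True f by (simp add: QX_sface chain_face_def)
      have "h u \<in> carr (fst P)" if "u \<in> carr U" for u
        using y that unfolding z QX_sec_iff by (auto simp: cart_hom_def)
      then have "compose (carr U) (snd Q) (compose (carr U) f h) = compose (carr U) (snd P) h"
        unfolding f(2)[symmetric] by (auto simp: compose_def)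
      then show ?thesis
        unfolding z face evaluate_plots_apply[OF U sf[unfolded face] s'] evaluate_plots_apply[OF U y[unfolded z] s]
        by simp
    next
      case False
      then have "\<exists>bs. sface (QX X) (Suc k) i U ((P, as), h) = ((P, bs), h)"
        by (simp add: QX_sface chain_face_def)
      then obtain bs where face: "sface (QX X) (Suc k) i U ((P, as), h) = ((P, bs), h)" ..
      show ?thesis
        unfolding z face evaluate_plots_apply[OF U sf[unfolded face] s'] evaluate_plots_apply[OF U y[unfolded z] s] ..
    qed
  qed
  moreover have "?e (Suc k) U (sdegen (QX X) k i U y, take (Suc i) s @ drop i s) = ?e k U (y, s)"
    if U: "U \<in> Cart" and i: "i \<le> k" and y: "y \<in> sec (QX X) k U" and s: "s \<in> std_simplex 0 k"
    for k U i y s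
  proof -
    obtain P as h where z: "y = ((P, as), h)" by (metis surj_pair)
    have s': "take (Suc i) s @ drop i s \<in> std_simplex 0 (Suc k)"
      using s i by (simp add: std_simplex_0 flip: replicate_Suc replicate_add)
    obtain bs where degen: "sdegen (QX X) k i U ((P, as), h) = ((P, bs), h)"
      by (auto simp: QX_sdegen chain_degen_def)
    show ?thesis
      unfolding z degen evaluate_plots_apply[OF U QX_sdegen_in[OF X y[unfolded z] i, unfolded degen] s']
        evaluate_plots_apply[OF U y[unfolded z] s] ..
  qed
  ultimately show ?thesis unfolding map_space_group_iff by blast
qed

lemma base_plot_sec:
  assumes "diffeological_space X" "x \<in> points X"
  shows "((base_plot x, []), \<lambda>u\<in>carr point_dom. u) \<in> sec (QX X) 0 point_dom"
  using base_plot_in[OF assms] cart_hom_ident[OF Cart_open[OF point_dom_Cart]]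
  by (simp add: QX_sec_iff) (simp add: base_plot_def)

text \<open>Recovers \<open>g\<close> from its presheaf map, which gives injectivity of the
  comparison.\<close>

lemma evaluate_plots_base:
  assumes X: "diffeological_space X" and x: "x \<in> points X"
  shows "evaluate_plots X g 0 point_dom (((base_plot x, []), \<lambda>u\<in>carr point_dom. u), [0]) (\<lambda>_. 0) = g x"
  by (subst evaluate_plots_apply[OF point_dom_Cart base_plot_sec[OF X x]])
    (simp_all add: std_simplex_0 compose_def base_plot_def)

text \<open>By Yoneda, a map out of \<open>QX\<close> amounts on vertices to a plot of
  \<open>A\<close> on the domain of every plot of \<open>X\<close>. Maps of plots force these to be
  compatible; comparison with the constant plots on R^0 shows that they all come from one function
  on \<open>X\<close>.\<close>

lemma evaluate_plots_surj:
  assumes X: "diffeological_space X" and A: "diffeological_abelian_group A"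
    and \<phi>: "\<phi> \<in> map_space (QX X) (group_spre A) 0"
  shows "\<exists>g\<in>smooth X (group_space A). evaluate_plots X g = \<phi>"
proof -
  let ?A = "group_space A"
  have SA: "diffeological_space ?A" using A by (simp add: diffeological_abelian_group_def)
  \<comment> \<open>The value on the universal section, the identity of the domain of
    \<open>P\<close>.\<close>
  define v where "v P = \<phi> 0 (fst P) (((P, []), \<lambda>u\<in>carr (fst P). u), [0])" for P
  have s0: "[0] \<in> std_simplex 0 0" and s1: "[0, 0] \<in> std_simplex 0 (Suc 0)" by (auto simp: std_simplex_0)
  have idn: "((P, []), \<lambda>u\<in>carr (fst P). u) \<in> sec (QX X) 0 (fst P)" if "P \<in> all_plots X" for P
    using that cart_hom_ident[OF Cart_open[OF all_plots_Cart[OF that]]] by (simp add: QX_sec_iff)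
  have v: "v P \<in> plots ?A (fst P)" if P: "P \<in> all_plots X" for P
    using map_space_in[OF \<phi> all_plots_Cart[OF P] idn[OF P] s0] smooth_cart_diff[OF SA all_plots_Cart[OF P]]
    by (simp add: v_def)
  have nat: "\<phi> 0 U (((P, []), h), [0]) = compose (carr U) (v P) h"
    if U: "U \<in> Cart" and P: "P \<in> all_plots X" and h: "h \<in> cart_hom U (fst P)" for U P h
  proof -
    have "compose (carr U) (\<lambda>u\<in>carr (fst P). u) h = h"
      using h by (intro ext) (auto simp: compose_def cart_hom_def PiE_iff extensional_def)
    then show ?thesis
      using map_space_restr[OF \<phi> all_plots_Cart[OF P] U h idn[OF P] s0] by (simp add: QX_restr v_def)
  qed
  have base: "v (base_plot (snd P u)) (\<lambda>_. 0) = v P u" if P: "P \<in> all_plots X" and u: "u \<in> carr (fst P)" for P u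
  proof -
    \<comment> \<open>The point \<open>u\<close> is a map of plots from the constant plot at
      \<open>snd P u\<close> to \<open>P\<close>. The two faces of this one-arrow chain give the two
      sides of the equation.\<close>
    let ?B = "base_plot (snd P u)" and ?f = "\<lambda>_\<in>carr point_dom. u" and ?i = "\<lambda>u\<in>carr point_dom. u"
    let ?z = "((?B, [(?B, ?f, P)]), ?i)"
    have x: "snd P u \<in> points X" using all_plots_extensional[OF X P] u by blast
    have f: "?f \<in> cart_hom point_dom (fst P)"
      by (rule cart_hom_const[OF Cart_open[OF point_dom_Cart] u])
    have "compose (carr point_dom) (snd P) ?f = snd ?B"
      by (auto simp: compose_def base_plot_def)
    then have "(?B, ?f, P) \<in> plot_maps X"
      using base_plot_in[OF X x] P f by (simp add: plot_maps_def) (simp add: base_plot_def)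
    then have z: "?z \<in> sec (QX X) (Suc 0) point_dom"
      using base_plot_sec[OF X x] by (simp add: QX_sec_iff)
    have "compose (carr point_dom) ?f ?i = ?f" by (auto simp: compose_def)
    then have "sface (QX X) (Suc 0) 0 point_dom ?z = ((P, []), ?f)"
      by (simp add: QX_sface chain_face_def)
    moreover have "sface (QX X) (Suc 0) (Suc 0) point_dom ?z = ((?B, []), ?i)"
      by (simp add: QX_sface chain_face_def)
    ultimately have "\<phi> 0 point_dom (((P, []), ?f), [0]) = \<phi> 0 point_dom (((?B, []), ?i), [0])"
      using map_space_face[OF \<phi> point_dom_Cart _ z s1, of 0]
        map_space_face[OF \<phi> point_dom_Cart _ z s1, of "Suc 0"] by simp
    moreover have "\<phi> 0 point_dom (((?B, []), ?i), [0]) = v ?B"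
      by (simp add: v_def) (simp add: base_plot_def)
    ultimately have "v ?B = compose (carr point_dom) (v P) ?f"
      using nat[OF point_dom_Cart P f] by simp
    then show ?thesis by (simp add: compose_def)
  qed
  define g where "g = (\<lambda>x\<in>points X. v (base_plot x) (\<lambda>_. 0))"
  have gv: "g (snd P u) = v P u" if "P \<in> all_plots X" "u \<in> carr (fst P)" for P u
    using base[OF that] all_plots_extensional[OF X that(1)] that(2) by (auto simp: g_def)
  have "v (base_plot x) (\<lambda>_. 0) \<in> carrier A" if "x \<in> points X" for x
    using plot_in_points[OF diffeological_space_ext[OF SA] all_plots_Cart v] base_plot_in[OF X that]
    by (fastforce simp: base_plot_def)
  moreover have "compose (carr U) g p \<in> plots ?A U" if U: "U \<in> Cart" and p: "p \<in> plots X U" for U p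
  proof -
    have P: "(U, p) \<in> all_plots X" using U p by (simp add: all_plots_def)
    have "v (U, p) \<in> extensional (carr U)"
      using v[OF P] diffeological_space_ext[OF SA] U by (auto simp: PiE_def)
    then have "compose (carr U) g p = v (U, p)"
      using gv[OF P] by (auto simp: compose_def extensional_def)
    then show ?thesis using v[OF P] by simp
  qed
  ultimately have g: "g \<in> smooth X ?A" by (simp add: smooth_def g_def)
  have "evaluate_plots X g = \<phi>"
  proof (rule map_space_eqI[OF evaluate_plots_in[OF X A g] \<phi>])
    fix k U y s assume U: "U \<in> Cart" and y: "y \<in> sec (QX X) k U" and s: "s \<in> std_simplex 0 k"
    obtain P as h where z: "y = ((P, as), h)" by (metis surj_pair)
    have P: "P \<in> all_plots X" "h \<in> cart_hom U (fst P)" using y unfolding z QX_sec_iff by auto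
    have "h u \<in> carr (fst P)" if "u \<in> carr U" for u using P(2) that by (auto simp: cart_hom_def)
    then have "compose (carr U) g (compose (carr U) (snd P) h) = compose (carr U) (v P) h"
      using gv[OF P(1)] by (auto simp: compose_def)
    moreover have "\<phi> k U (y, s) = \<phi> 0 U (((P, []), h), [0])"
      using map_space_vertex[OF \<phi> U y[unfolded z] s] s by (simp add: z std_simplex_0)
    ultimately show "evaluate_plots X g k U (y, s) = \<phi> k U (y, s)"
      unfolding z using evaluate_plots_apply[OF U y[unfolded z] s, of g] nat[OF U P] by simp
  qed
  then show ?thesis using g by blast
qed

lemma H0_inf_iso:
  fixes X :: "'x diffeology" and A :: "'a diff_group"
  assumes X: "diffeological_space X" and A: "diffeological_abelian_group A"
  shows "smooth_group X A \<cong> H0_inf X A"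
proof -
  let ?M = "map_space (QX X) (group_spre A) 0" and ?e = "evaluate_plots X" and ?A = "group_space A"
  let ?S = "\<lambda>k U. sec (times_simplex (QX X) 0) k U"
  let ?plus = "\<lambda>\<phi> \<psi> k. \<lambda>U\<in>Cart. \<lambda>z\<in>?S k U. \<phi> k U z \<otimes>\<^bsub>smooth_group (cart_diff U) A\<^esub> \<psi> k U z"
  have R: "pi0_rel (QX X) (group_spre A) = Id_on ?M" by (rule pi0_rel_QX[OF X])
  have c: "carrier (H0_inf X A) = (\<lambda>\<phi>. {\<phi>}) ` ?M"
    unfolding H0_inf_def Let_def R by (auto simp: quotient_def Id_on_def)
  have m: "{\<phi>} \<otimes>\<^bsub>H0_inf X A\<^esub> {\<psi>} = Id_on ?M `` {?plus \<phi> \<psi>}" for \<phi> \<psi>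
    unfolding H0_inf_def Let_def R by simp
  interpret comm_group "smooth_group X A"
    by (rule smooth_group_comm_group[OF A diffeological_space_ext[OF X]])
  have in_M: "?e g \<in> ?M" if "g \<in> carrier (smooth_group X A)" for g
    using evaluate_plots_in[OF X A] that by simp
  have plus: "?e (g \<otimes>\<^bsub>smooth_group X A\<^esub> h) = ?plus (?e g) (?e h)" for g h
  proof (intro ext)
    fix k U z u
    show "?e (g \<otimes>\<^bsub>smooth_group X A\<^esub> h) k U z u = ?plus (?e g) (?e h) k U z u"
    proof (cases "U \<in> Cart \<and> z \<in> ?S k U")
      case True
      obtain P as f s where z: "z = (((P, as), f), s)" by (metis surj_pair)
      have y: "((P, as), f) \<in> sec (QX X) k U" and s: "s \<in> std_simplex 0 k" and U: "U \<in> Cart"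
        using True by (auto simp: z times_simplex_simps)
      have P: "P \<in> all_plots X" "f \<in> cart_hom U (fst P)" using y unfolding QX_sec_iff by auto
      have "snd P (f u) \<in> points X" if "u \<in> carr U"
      proof -
        have "f u \<in> carr (fst P)" using P(2) that by (auto simp: cart_hom_def)
        then show ?thesis using all_plots_extensional[OF X P(1)] by blast
      qed
      then have "compose (carr U) (g \<otimes>\<^bsub>smooth_group X A\<^esub> h) (compose (carr U) (snd P) f) u
          = (compose (carr U) g (compose (carr U) (snd P) f)
             \<otimes>\<^bsub>smooth_group (cart_diff U) A\<^esub> compose (carr U) h (compose (carr U) (snd P) f)) u"
        by (simp add: compose_def cart_diff_def)
      then show ?thesis
        using True unfolding z by (simp add: evaluate_plots_apply[OF U y s])
    next
      case False
      then show ?thesis by (auto simp: evaluate_plots_def)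
    qed
  qed
  have "(\<lambda>g. {?e g}) \<in> iso (smooth_group X A) (H0_inf X A)"
  proof (rule isoI)
    show "(\<lambda>g. {?e g}) \<in> hom (smooth_group X A) (H0_inf X A)"
    proof (rule homI)
      fix g h assume g: "g \<in> carrier (smooth_group X A)" and h: "h \<in> carrier (smooth_group X A)"
      \<comment> \<open>The image under \<open>Id_on ?M\<close> is nonempty only if the sum lies in
        \<open>?M\<close>; it does, being the evaluation map of a product.\<close>
      show "{?e (g \<otimes>\<^bsub>smooth_group X A\<^esub> h)} = {?e g} \<otimes>\<^bsub>H0_inf X A\<^esub> {?e h}"
        using in_M[OF m_closed[OF g h]] unfolding m plus by blast
    qed (use in_M c in blast)
    show "bij_betw (\<lambda>g. {?e g}) (carrier (smooth_group X A)) (carrier (H0_inf X A))"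
    proof (rule bij_betw_imageI)
      show "inj_on (\<lambda>g. {?e g}) (carrier (smooth_group X A))"
      proof (rule inj_onI)
        fix g h
        assume g: "g \<in> carrier (smooth_group X A)" and h: "h \<in> carrier (smooth_group X A)" and "{?e g} = {?e h}"
        then have "?e g = ?e h" by simp
        then have "g x = h x" if "x \<in> points X" for x using evaluate_plots_base[OF X that] by metis
        then show "g = h" using g h smooth_eqI[of g X ?A h ?A] by simp
      qed
      have "?M \<subseteq> ?e ` carrier (smooth_group X A)"
        using evaluate_plots_surj[OF X A] by fastforce
      then show "(\<lambda>g. {?e g}) ` carrier (smooth_group X A) = carrier (H0_inf X A)"
        unfolding c using in_M by blast
    qed
  qed
  then show ?thesis by (auto simp: is_iso_def)
qed

theorem corollary5p38:
  fixes X :: "'x diffeology" and A :: "'a diff_group"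
  assumes "diffeological_space X"
    and "diffeological_abelian_group A"
  shows "H0_inf X A \<cong> H_PIZ 0 X A \<and>
         H_PIZ 0 X A \<cong> H_KWW 0 X A \<and>
         H_KWW 0 X A \<cong> smooth_group X A"
proof -
  interpret comm_group "smooth_group X A"
    by (rule smooth_group_comm_group[OF assms(2) diffeological_space_ext[OF assms(1)]])
  \<comment> \<open>All three isomorphisms start at the group of smooth maps on \<open>X\<close>, so
    they can be inverted and joined there.\<close>
  note iso = H0_inf_iso[OF assms] H_PIZ_iso[OF assms] H_KWW_iso[OF assms]
  show ?thesis
    by (intro conjI iso_trans[OF iso_sym[OF iso(1)] iso(2)] iso_trans[OF iso_sym[OF iso(2)] iso(3)] iso_sym[OF iso(3)])
qed

end
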